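(* Let $A$ be a $C^*$-algebra, $\mathcal{H}$ a Hilbert space, $\varphi:A\to L(\mathcal{H})$ a completely positive linear map, and let $\Phi$ and $\Psi$ be two operator-valued $\varphi$-maps on a Hilbert $A$-module $X$ (that is, $\varphi$-maps $\Phi:X\to L(\mathcal{H},\mathcal{K}_1)$ and $\Psi:X\to L(\mathcal{H},\mathcal{K}_2)$ for some Hilbert spaces $\mathcal{K}_1,\mathcal{K}_2$). Then $M_{\widetilde{\varphi}_\Phi}=M_{\widetilde{\varphi}_\Psi}$ and $T_{\widetilde{\varphi}_\Phi}=T_{\widetilde{\varphi}_\Psi}$.
   Context: Hilbert $C^*$-modules are right modules, with inner product linear in the second variable. $L(\mathcal{H},\mathcal{K})$ denotes bounded linear operators, $L(\mathcal{H})=L(\mathcal{H},\mathcal{H})$, and $[\,\cdot\,]$ closed linear span. A map $\Phi:X\to L(\mathcal{H},\mathcal{K})$ is a $\varphi$-map if $\Phi(x)^*\Phi(y)=\varphi(\langle x,y\rangle)$ for all $x,y\in X$; if $\varphi$ is a $*$-homomorphism it is called a $\varphi$-representation. For a completely positive map $\psi:B\to L(\mathcal{E})$ on a $C^*$-algebra $B$: $M_\psi=\{a\in B:\psi(ab)=\psi(a)\psi(b),\ \psi(ba)=\psi(b)\psi(a)\ \forall b\in B\}$ and $T_\psi=\{a\in M_\psi:\psi(ba^*c)=\psi(b)\psi(a)^*\psi(c)\ \forall b,c\in B\}$. $K(X)$ is the $C^*$-algebra of compact operators on $X$, the closed linear span of the operators $\theta_{x,y}(z)=x\langle y,z\rangle$.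 The linking $C^*$-algebra is $\mathcal{L}(X)=\left\{\begin{bmatrix}T&x\\ y^*&a\end{bmatrix}:T\in K(X),\ x,y\in X,\ a\in A\right\}$, identified with the compact operators on $X\oplus A$ (here $x$ is the operator $a\mapsto xa$, $y^*$ is $z\mapsto\langle y,z\rangle$, and $a$ is left multiplication). A minimal Stinespring representation associated to $(\varphi,\Phi)$, $\Phi:X\to L(\mathcal{H},\mathcal{K})$, consists of Hilbert spaces $\mathcal{H}',\mathcal{K}'$, a $*$-representation $\pi:A\to L(\mathcal{H}')$, a $\pi$-representation $\Pi:X\to L(\mathcal{H}',\mathcal{K}')$, a bounded operator $V:\mathcal{H}\to\mathcal{H}'$ and a coisometry $W:\mathcal{K}\to\mathcal{K}'$ with $\varphi(\cdot)=V^*\pi(\cdot)V$, $[\pi(A)V\mathcal{H}]=\mathcal{H}'$, $\Phi(\cdot)=W^*\Pi(\cdot)V$, $[\Pi(X)V\mathcal{H}]=\mathcal{K}'$; such a representation exists. $\phi_{\Phi,\varphi}:K(X)\to L(\mathcal{K})$ is the $*$-representation determined by $\phi_{\Phi,\varphi}(\theta_{x,y})=W^*\Pi(x)\Pi(y)^*W$ (independent of the choice of minimal Stinespring representation), and $\widetilde{\varphi}_\Phi:\mathcal{L}(X)\to L(\mathcal{K}\oplus\mathcal{H})$ is the completely positive map $\begin{bmatrix}T&x\\ y^*&a\end{bmatrix}\mapsto\begin{bmatrix}\phi_{\Phi,\varphi}(T)&\Phi(x)\\ \Phi(y)^*&\varphi(a)\end{bmatrix}$. *)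

theory Defs
  imports "HOL-Analysis.Analysis"
begin

section \<open>Complex vector spaces, Hilbert spaces and C*-algebras\<close>

class complex_vector = real_vector +
  fixes scaleC :: "complex \<Rightarrow> 'a \<Rightarrow> 'a"  (infixr "*\<^sub>C" 75)
  assumes scaleC_add_right: "c *\<^sub>C (x + y) = c *\<^sub>C x + c *\<^sub>C y"
    and scaleC_add_left: "(c + d) *\<^sub>C x = c *\<^sub>C x + d *\<^sub>C x"
    and scaleC_scaleC: "c *\<^sub>C d *\<^sub>C x = (c * d) *\<^sub>C x"
    and scaleC_of_real: "complex_of_real r *\<^sub>C x = r *\<^sub>R x"

lemma scaleC_one: "1 *\<^sub>C x = (x :: 'a::complex_vector)"
  using scaleC_of_real[of 1 x] by simp

global_interpretation complex_vector: vector_space "scaleC :: complex \<Rightarrow> 'a \<Rightarrow> 'a :: complex_vector"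
  defines cspan = complex_vector.span
  by unfold_locales (simp_all add: scaleC_add_right scaleC_add_left scaleC_scaleC scaleC_one)

abbreviation clinear :: "('a::complex_vector \<Rightarrow> 'b::complex_vector) \<Rightarrow> bool" where
  "clinear \<equiv> Vector_Spaces.linear (*\<^sub>C) (*\<^sub>C)"

lemma clinear_iff:
  "clinear f \<longleftrightarrow> (\<forall>x y. f (x + y) = f x + f y) \<and> (\<forall>c x. f (c *\<^sub>C x) = c *\<^sub>C f x)"
  by (auto simp: Vector_Spaces.linear_def module_hom_def module_hom_axioms_def
      complex_vector.module_axioms complex_vector.vector_space_axioms)

class complex_normed_vector = complex_vector + real_normed_vector +
  assumes norm_scaleC: "norm (c *\<^sub>C x) = cmod c * norm x"

class complex_banach = complex_normed_vector + banach

text \<open>Inner products are conjugate-linear in the first and linear in the second variable.\<close>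

class complex_hilbert = complex_banach +
  fixes cinner :: "'a \<Rightarrow> 'a \<Rightarrow> complex"
  assumes cinner_add_right: "cinner x (y + z) = cinner x y + cinner x z"
    and cinner_scaleC_right: "cinner x (c *\<^sub>C y) = c * cinner x y"
    and cinner_commute: "cinner y x = cnj (cinner x y)"
    and cinner_norm: "cinner x x = complex_of_real ((norm x)\<^sup>2)"

text \<open>C*-algebras are not assumed to be unital.\<close>

class cstar_algebra = complex_banach + real_normed_algebra +
  fixes star :: "'a \<Rightarrow> 'a"
  assumes mult_scaleC_left: "(c *\<^sub>C a) * b = c *\<^sub>C (a * b)"
    and mult_scaleC_right: "a * (c *\<^sub>C b) = c *\<^sub>C (a * b)"
    and star_add: "star (a + b) = star a + star b"
    and star_scaleC: "star (c *\<^sub>C a) = cnj c *\<^sub>C star a"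
    and star_mult: "star (a * b) = star b * star a"
    and star_star: "star (star a) = a"
    and cstar_identity: "norm (star a * a) = (norm a)\<^sup>2"

definition cstar_positive :: "'a::cstar_algebra \<Rightarrow> bool" where
  "cstar_positive a \<longleftrightarrow> (\<exists>b. a = star b * b)"

instantiation prod :: (complex_vector, complex_vector) complex_vector
begin

definition scaleC_prod :: "complex \<Rightarrow> 'a \<times> 'b \<Rightarrow> 'a \<times> 'b" where
  "scaleC_prod c p = (c *\<^sub>C fst p, c *\<^sub>C snd p)"

instance
  by standard (simp_all add: scaleC_prod_def scaleC_add_right scaleC_add_left scaleC_scaleC
      scaleC_of_real scaleR_prod_def)

end

lemma scaleC_Pair: "c *\<^sub>C (x, y) = (c *\<^sub>C x, c *\<^sub>C y)"
  by (simp add: scaleC_prod_def)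

instance prod :: (complex_normed_vector, complex_normed_vector) complex_normed_vector
proof
  fix c and p :: "'a \<times> 'b"
  have "norm (c *\<^sub>C p) = sqrt ((cmod c)\<^sup>2 * ((norm (fst p))\<^sup>2 + (norm (snd p))\<^sup>2))"
    by (simp add: norm_prod_def scaleC_prod_def norm_scaleC power_mult_distrib distrib_left)
  then show "norm (c *\<^sub>C p) = cmod c * norm p"
    by (simp add: norm_prod_def real_sqrt_mult)
qed

instance prod :: (complex_banach, complex_banach) complex_banach ..

instantiation prod :: (complex_hilbert, complex_hilbert) complex_hilbert
begin

definition cinner_prod :: "'a \<times> 'b \<Rightarrow> 'a \<times> 'b \<Rightarrow> complex" where
  "cinner_prod p q = cinner (fst p) (fst q) + cinner (snd p) (snd q)"

instance
proof
  fix p q r :: "'a \<times> 'b" and c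
  show "cinner p (q + r) = cinner p q + cinner p r"
    by (simp add: cinner_prod_def cinner_add_right)
  show "cinner p (c *\<^sub>C q) = c * cinner p q"
    by (simp add: cinner_prod_def scaleC_prod_def cinner_scaleC_right distrib_left)
  show "cinner q p = cnj (cinner p q)"
    unfolding cinner_prod_def complex_cnj_add
    using cinner_commute[of "fst q" "fst p"] cinner_commute[of "snd q" "snd p"] by argo
  show "cinner p p = complex_of_real ((norm p)\<^sup>2)"
    by (simp add: cinner_prod_def cinner_norm norm_prod_def)
qed

end

section \<open>Bounded complex-linear operators\<close>

definition bounded_clinear :: "('a::complex_normed_vector \<Rightarrow> 'b::complex_normed_vector) \<Rightarrow> bool" where
  "bounded_clinear f \<longleftrightarrow> bounded_linear f \<and> (\<forall>c x. f (c *\<^sub>C x) = c *\<^sub>C f x)"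

lemma bounded_clinear_zero: "bounded_clinear (\<lambda>x. 0)"
  by (simp add: bounded_clinear_def bounded_linear_zero)

typedef (overloaded) ('a, 'b) clop (\<open>(_ \<Rightarrow>\<^sub>\<complex> /_)\<close> [22, 21] 21) =
  "{f :: 'a::complex_normed_vector \<Rightarrow> 'b::complex_normed_vector. bounded_clinear f}"
  morphisms clop_apply Clop
  using bounded_clinear_zero by blast

declare [[coercion
  "clop_apply :: ('a::complex_normed_vector \<Rightarrow>\<^sub>\<complex> 'b::complex_normed_vector) \<Rightarrow> 'a \<Rightarrow> 'b"]]

setup_lifting type_definition_clop

lemma Clop_apply: "bounded_clinear f \<Longrightarrow> clop_apply (Clop f) = f"
  by (simp add: Clop_inverse)

lemma clop_eqI: "(\<And>x. clop_apply S x = clop_apply T x) \<Longrightarrow> S = T"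
  by (metis clop_apply_inject ext)

lemma bounded_linear_scaleC: "bounded_linear (\<lambda>x :: 'a::complex_normed_vector. c *\<^sub>C x)"
proof (rule bounded_linear_intro[of _ "cmod c"])
  fix r and x y :: 'a
  show "c *\<^sub>C (x + y) = c *\<^sub>C x + c *\<^sub>C y" by (rule scaleC_add_right)
  show "c *\<^sub>C r *\<^sub>R x = r *\<^sub>R c *\<^sub>C x"
    by (simp add: scaleC_of_real[symmetric] scaleC_scaleC mult.commute)
  show "norm (c *\<^sub>C x) \<le> norm x * cmod c" by (simp add: norm_scaleC mult.commute)
qed

lemma onorm_scaleC:
  fixes f :: "'a::complex_normed_vector \<Rightarrow> 'b::complex_normed_vector"
  assumes "bounded_linear f"
  shows "onorm (\<lambda>x. c *\<^sub>C f x) = cmod c * onorm f"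
proof -
  have "onorm (\<lambda>x. c *\<^sub>C f x) = onorm (\<lambda>x. cmod c *\<^sub>R f x)"
    by (simp add: onorm_def norm_scaleC)
  then show ?thesis using onorm_scaleR[OF assms, of "cmod c"] by simp
qed

instantiation clop :: (complex_normed_vector, complex_normed_vector) complex_normed_vector
begin

lift_definition norm_clop :: "'a \<Rightarrow>\<^sub>\<complex> 'b \<Rightarrow> real" is onorm .

lift_definition minus_clop :: "'a \<Rightarrow>\<^sub>\<complex> 'b \<Rightarrow> 'a \<Rightarrow>\<^sub>\<complex> 'b \<Rightarrow> 'a \<Rightarrow>\<^sub>\<complex> 'b" is "\<lambda>f g x. f x - g x"
  by (simp add: bounded_clinear_def bounded_linear_sub complex_vector.scale_right_diff_distrib)

lift_definition plus_clop :: "'a \<Rightarrow>\<^sub>\<complex> 'b \<Rightarrow> 'a \<Rightarrow>\<^sub>\<complex> 'b \<Rightarrow> 'a \<Rightarrow>\<^sub>\<complex> 'b" is "\<lambda>f g x. f x + g x"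
  by (simp add: bounded_clinear_def bounded_linear_add scaleC_add_right)

lift_definition uminus_clop :: "'a \<Rightarrow>\<^sub>\<complex> 'b \<Rightarrow> 'a \<Rightarrow>\<^sub>\<complex> 'b" is "\<lambda>f x. - f x"
  by (simp add: bounded_clinear_def bounded_linear_minus)

lift_definition zero_clop :: "'a \<Rightarrow>\<^sub>\<complex> 'b" is "\<lambda>x. 0"
  by (rule bounded_clinear_zero)

lift_definition scaleC_clop :: "complex \<Rightarrow> 'a \<Rightarrow>\<^sub>\<complex> 'b \<Rightarrow> 'a \<Rightarrow>\<^sub>\<complex> 'b" is "\<lambda>c f x. c *\<^sub>C f x"
  by (auto simp: bounded_clinear_def scaleC_scaleC mult.commute
      intro: bounded_linear_compose[OF bounded_linear_scaleC])

definition scaleR_clop :: "real \<Rightarrow> 'a \<Rightarrow>\<^sub>\<complex> 'b \<Rightarrow> 'a \<Rightarrow>\<^sub>\<complex> 'b" where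
  "scaleR_clop r T = complex_of_real r *\<^sub>C T"

definition dist_clop :: "'a \<Rightarrow>\<^sub>\<complex> 'b \<Rightarrow> 'a \<Rightarrow>\<^sub>\<complex> 'b \<Rightarrow> real" where
  "dist_clop S T = norm (S - T)"

definition sgn_clop :: "'a \<Rightarrow>\<^sub>\<complex> 'b \<Rightarrow> 'a \<Rightarrow>\<^sub>\<complex> 'b" where
  "sgn_clop T = inverse (norm T) *\<^sub>R T"

definition uniformity_clop :: "(('a \<Rightarrow>\<^sub>\<complex> 'b) \<times> ('a \<Rightarrow>\<^sub>\<complex> 'b)) filter" where
  "uniformity_clop = (INF e\<in>{0 <..}. principal {(S, T). dist S T < e})"

definition open_clop :: "('a \<Rightarrow>\<^sub>\<complex> 'b) set \<Rightarrow> bool" where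
  "open_clop U = (\<forall>S\<in>U. \<forall>\<^sub>F (S', T) in uniformity. S' = S \<longrightarrow> T \<in> U)"

instance
proof
  fix S T U :: "'a \<Rightarrow>\<^sub>\<complex> 'b" and c d :: complex and r s :: real and Q :: "('a \<Rightarrow>\<^sub>\<complex> 'b) set"
  show "S + T + U = S + (T + U)" "S + T = T + S" "0 + S = S" "- S + S = 0" "S - T = S + - T"
    by (transfer, simp add: add_ac)+
  show cr: "c *\<^sub>C (S + T) = c *\<^sub>C S + c *\<^sub>C T" for c by transfer (simp add: scaleC_add_right)
  show cl: "(c + d) *\<^sub>C S = c *\<^sub>C S + d *\<^sub>C S" for c d by transfer (simp add: scaleC_add_left)
  show cc: "c *\<^sub>C d *\<^sub>C S = (c * d) *\<^sub>C S" for c d by transfer (simp add: scaleC_scaleC)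
  show "complex_of_real r *\<^sub>C S = r *\<^sub>R S" by (simp add: scaleR_clop_def)
  show "r *\<^sub>R (S + T) = r *\<^sub>R S + r *\<^sub>R T" by (simp add: scaleR_clop_def cr)
  show "(r + s) *\<^sub>R S = r *\<^sub>R S + s *\<^sub>R S" by (simp add: scaleR_clop_def cl)
  show "r *\<^sub>R s *\<^sub>R S = (r * s) *\<^sub>R S" by (simp add: scaleR_clop_def cc)
  show "1 *\<^sub>R S = S" unfolding scaleR_clop_def by transfer (simp add: scaleC_one)
  show nC: "norm (c *\<^sub>C S) = cmod c * norm S" for c
    by transfer (simp add: onorm_scaleC bounded_clinear_def)
  show "norm (r *\<^sub>R S) = \<bar>r\<bar> * norm S" by (simp add: scaleR_clop_def nC)
  show "norm (S + T) \<le> norm S + norm T"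
    by transfer (simp add: onorm_triangle bounded_clinear_def)
  show "norm S = 0 \<longleftrightarrow> S = 0"
    by transfer (auto simp: onorm_eq_0 bounded_clinear_def fun_eq_iff)
  show "dist S T = norm (S - T)" "sgn S = inverse (norm S) *\<^sub>R S"
    by (simp_all add: dist_clop_def sgn_clop_def)
  show "(uniformity :: (('a \<Rightarrow>\<^sub>\<complex> 'b) \<times> ('a \<Rightarrow>\<^sub>\<complex> 'b)) filter)
      = (INF e\<in>{0 <..}. principal {(S, T). dist S T < e})"
    by (rule uniformity_clop_def)
  show "open Q \<longleftrightarrow> (\<forall>S\<in>Q. \<forall>\<^sub>F (S', T) in uniformity. S' = S \<longrightarrow> T \<in> Q)"
    by (rule open_clop_def)
qed

end

lift_definition clop_id :: "'a::complex_normed_vector \<Rightarrow>\<^sub>\<complex> 'a" is "\<lambda>x. x"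
  by (simp add: bounded_clinear_def bounded_linear_ident)

lift_definition clop_compose ::
  "'b::complex_normed_vector \<Rightarrow>\<^sub>\<complex> 'c::complex_normed_vector \<Rightarrow> 'a::complex_normed_vector \<Rightarrow>\<^sub>\<complex> 'b \<Rightarrow> 'a \<Rightarrow>\<^sub>\<complex> 'c"
  (infixl "o\<^sub>C" 67) is "\<lambda>f g x. f (g x)"
  by (simp add: bounded_clinear_def bounded_linear_compose)

lift_definition block_op ::
  "'a::complex_normed_vector \<Rightarrow>\<^sub>\<complex> 'c::complex_normed_vector \<Rightarrow> 'b::complex_normed_vector \<Rightarrow>\<^sub>\<complex> 'c
    \<Rightarrow> 'a \<Rightarrow>\<^sub>\<complex> 'd::complex_normed_vector \<Rightarrow> 'b \<Rightarrow>\<^sub>\<complex> 'd \<Rightarrow> ('a \<times> 'b) \<Rightarrow>\<^sub>\<complex> ('c \<times> 'd)"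
  is "\<lambda>P Q R S v. (P (fst v) + Q (snd v), R (fst v) + S (snd v))"
proof (unfold bounded_clinear_def, intro conjI allI)
  fix P :: "'a \<Rightarrow> 'c" and Q :: "'b \<Rightarrow> 'c" and R :: "'a \<Rightarrow> 'd" and S :: "'b \<Rightarrow> 'd"
  assume *: "bounded_linear P \<and> (\<forall>c x. P (c *\<^sub>C x) = c *\<^sub>C P x)"
    "bounded_linear Q \<and> (\<forall>c x. Q (c *\<^sub>C x) = c *\<^sub>C Q x)"
    "bounded_linear R \<and> (\<forall>c x. R (c *\<^sub>C x) = c *\<^sub>C R x)"
    "bounded_linear S \<and> (\<forall>c x. S (c *\<^sub>C x) = c *\<^sub>C S x)"
  have bl: "bounded_linear (\<lambda>v. f (fst v) + g (snd v))" if "bounded_linear f" "bounded_linear g"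
    for f :: "'a \<Rightarrow> 'e::real_normed_vector" and g :: "'b \<Rightarrow> 'e"
    using that by (intro bounded_linear_add bounded_linear_compose[OF _ bounded_linear_fst]
        bounded_linear_compose[OF _ bounded_linear_snd])
  show "bounded_linear (\<lambda>v. (P (fst v) + Q (snd v), R (fst v) + S (snd v)))"
    using * by (intro bounded_linear_Pair bl) auto
  show "(P (fst (c *\<^sub>C v)) + Q (snd (c *\<^sub>C v)), R (fst (c *\<^sub>C v)) + S (snd (c *\<^sub>C v)))
      = c *\<^sub>C (P (fst v) + Q (snd v), R (fst v) + S (snd v))" for c v
    using * by (simp add: scaleC_prod_def scaleC_add_right)
qed

text \<open>
  The adjoint with respect to two (scalar- or algebra-valued) inner products; a meaningful value
  only if an adjoint exists, which on Hilbert spaces is always the case.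
\<close>

definition adj_wrt :: "('a::complex_normed_vector \<Rightarrow> 'a \<Rightarrow> 'c) \<Rightarrow> ('b::complex_normed_vector \<Rightarrow> 'b \<Rightarrow> 'c)
    \<Rightarrow> 'a \<Rightarrow>\<^sub>\<complex> 'b \<Rightarrow> 'b \<Rightarrow>\<^sub>\<complex> 'a" where
  "adj_wrt ipa ipb T = (THE S. \<forall>x y. ipb (clop_apply T x) y = ipa x (clop_apply S y))"

definition adj :: "'h::complex_hilbert \<Rightarrow>\<^sub>\<complex> 'k::complex_hilbert \<Rightarrow> 'k \<Rightarrow>\<^sub>\<complex> 'h" where
  "adj = adj_wrt cinner cinner"

section \<open>Representations, complete positivity, multiplicative and ternary domains\<close>

text \<open>
  C*-algebras of operators on a Hilbert module depend on that module and are therefore given by a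
  carrier set \<open>B\<close> together with a multiplication and an involution.
\<close>

definition star_rep :: "'b::complex_vector set \<Rightarrow> ('b \<Rightarrow> 'b \<Rightarrow> 'b) \<Rightarrow> ('b \<Rightarrow> 'b)
    \<Rightarrow> ('b \<Rightarrow> 'h::complex_hilbert \<Rightarrow>\<^sub>\<complex> 'h) \<Rightarrow> bool" where
  "star_rep B mul st \<pi> \<longleftrightarrow>
    (\<forall>a\<in>B. \<forall>b\<in>B. \<pi> (a + b) = \<pi> a + \<pi> b) \<and>
    (\<forall>c. \<forall>a\<in>B. \<pi> (c *\<^sub>C a) = c *\<^sub>C \<pi> a) \<and>
    (\<forall>a\<in>B. \<forall>b\<in>B. \<pi> (mul a b) = \<pi> a o\<^sub>C \<pi> b) \<and>
    (\<forall>a\<in>B. \<pi> (st a) = adj (\<pi> a))"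

text \<open>
  Matrices over \<open>A\<close> are functions on pairs of indices below \<open>n\<close>. The positive elements of the
  C*-algebra of these matrices are the products of some \<open>Q\<close> with its adjoint on the left; a matrix
  over \<open>L(H)\<close> is positive as an operator on the \<open>n\<close>-fold direct sum of \<open>H\<close>.
\<close>

definition mat_positive :: "nat \<Rightarrow> (nat \<Rightarrow> nat \<Rightarrow> 'a::cstar_algebra) \<Rightarrow> bool" where
  "mat_positive n P \<longleftrightarrow> (\<exists>Q. \<forall>i<n. \<forall>j<n. P i j = (\<Sum>k<n. star (Q k i) * Q k j))"

definition op_mat_positive :: "nat \<Rightarrow> (nat \<Rightarrow> nat \<Rightarrow> 'h::complex_hilbert \<Rightarrow>\<^sub>\<complex> 'h) \<Rightarrow> bool" where
  "op_mat_positive n T \<longleftrightarrow>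
    (\<forall>h :: nat \<Rightarrow> 'h. (\<Sum>i<n. \<Sum>j<n. cinner (h i) (T i j (h j))) \<in> \<real>\<^sub>\<ge>\<^sub>0)"

definition completely_positive :: "('a::cstar_algebra \<Rightarrow> 'h::complex_hilbert \<Rightarrow>\<^sub>\<complex> 'h) \<Rightarrow> bool" where
  "completely_positive \<phi> \<longleftrightarrow>
    clinear \<phi> \<and> (\<forall>n P. mat_positive n P \<longrightarrow> op_mat_positive n (\<lambda>i j. \<phi> (P i j)))"

definition mult_domain :: "'b set \<Rightarrow> ('b \<Rightarrow> 'b \<Rightarrow> 'b) \<Rightarrow> ('b \<Rightarrow> 'e::complex_hilbert \<Rightarrow>\<^sub>\<complex> 'e) \<Rightarrow> 'b set"
  where
  "mult_domain B mul \<psi> =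
    {a \<in> B. \<forall>b\<in>B. \<psi> (mul a b) = \<psi> a o\<^sub>C \<psi> b \<and> \<psi> (mul b a) = \<psi> b o\<^sub>C \<psi> a}"

definition ternary_domain ::
  "'b set \<Rightarrow> ('b \<Rightarrow> 'b \<Rightarrow> 'b) \<Rightarrow> ('b \<Rightarrow> 'b) \<Rightarrow> ('b \<Rightarrow> 'e::complex_hilbert \<Rightarrow>\<^sub>\<complex> 'e) \<Rightarrow> 'b set" where
  "ternary_domain B mul st \<psi> =
    {a \<in> mult_domain B mul \<psi>.
      \<forall>b\<in>B. \<forall>c\<in>B. \<psi> (mul (mul b (st a)) c) = \<psi> b o\<^sub>C adj (\<psi> a) o\<^sub>C \<psi> c}"

section \<open>Hilbert modules\<close>

text \<open>
  \<open>act x a\<close> is the right action \<open>x a\<close>, and \<open>ip\<close> is the \<open>A\<close>-valued inner product. The norm of the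
  type is the norm of the module, which also makes \<open>ip\<close> definite.
\<close>

locale hilbert_module =
  fixes act :: "'x::complex_banach \<Rightarrow> 'a::cstar_algebra \<Rightarrow> 'x"
    and ip :: "'x \<Rightarrow> 'x \<Rightarrow> 'a"
  assumes act_add_left: "act (x + y) a = act x a + act y a"
    and act_add_right: "act x (a + b) = act x a + act x b"
    and act_act: "act (act x a) b = act x (a * b)"
    and act_scaleC_left: "act (c *\<^sub>C x) a = c *\<^sub>C act x a"
    and act_scaleC_right: "act x (c *\<^sub>C a) = c *\<^sub>C act x a"
    and ip_add_right: "ip x (y + z) = ip x y + ip x z"
    and ip_scaleC_right: "ip x (c *\<^sub>C y) = c *\<^sub>C ip x y"
    and ip_act_right: "ip x (act y a) = ip x y * a"
    and ip_commute: "ip y x = star (ip x y)"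
    and ip_positive: "cstar_positive (ip x x)"
    and norm_eq: "norm x = sqrt (norm (ip x x))"

text \<open>The entries of the linking algebra, as operators between \<open>X\<close> and \<open>A\<close>.\<close>

definition ket_op :: "('x::complex_banach \<Rightarrow> 'a::cstar_algebra \<Rightarrow> 'x) \<Rightarrow> 'x \<Rightarrow> 'a \<Rightarrow>\<^sub>\<complex> 'x" where
  "ket_op act x = Clop (\<lambda>a. act x a)"

definition bra_op :: "('x::complex_banach \<Rightarrow> 'x \<Rightarrow> 'a::cstar_algebra) \<Rightarrow> 'x \<Rightarrow> 'x \<Rightarrow>\<^sub>\<complex> 'a" where
  "bra_op ip y = Clop (\<lambda>z. ip y z)"

definition lmult_op :: "'a::cstar_algebra \<Rightarrow> 'a \<Rightarrow>\<^sub>\<complex> 'a" where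
  "lmult_op a = Clop (\<lambda>b. a * b)"

definition theta :: "('x::complex_banach \<Rightarrow> 'a::cstar_algebra \<Rightarrow> 'x) \<Rightarrow> ('x \<Rightarrow> 'x \<Rightarrow> 'a)
    \<Rightarrow> 'x \<Rightarrow> 'x \<Rightarrow> 'x \<Rightarrow>\<^sub>\<complex> 'x" where
  "theta act ip x y = Clop (\<lambda>z. act x (ip y z))"

definition compact_ops :: "('x::complex_banach \<Rightarrow> 'a::cstar_algebra \<Rightarrow> 'x) \<Rightarrow> ('x \<Rightarrow> 'x \<Rightarrow> 'a)
    \<Rightarrow> ('x \<Rightarrow>\<^sub>\<complex> 'x) set" where
  "compact_ops act ip = closure (cspan {theta act ip x y | x y. True})"

definition linking_op :: "('x::complex_banach \<Rightarrow> 'a::cstar_algebra \<Rightarrow> 'x) \<Rightarrow> ('x \<Rightarrow> 'x \<Rightarrow> 'a)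
    \<Rightarrow> 'x \<Rightarrow>\<^sub>\<complex> 'x \<Rightarrow> 'x \<Rightarrow> 'x \<Rightarrow> 'a \<Rightarrow> ('x \<times> 'a) \<Rightarrow>\<^sub>\<complex> ('x \<times> 'a)" where
  "linking_op act ip T x y a = block_op T (ket_op act x) (bra_op ip y) (lmult_op a)"

definition linking_algebra :: "('x::complex_banach \<Rightarrow> 'a::cstar_algebra \<Rightarrow> 'x) \<Rightarrow> ('x \<Rightarrow> 'x \<Rightarrow> 'a)
    \<Rightarrow> (('x \<times> 'a) \<Rightarrow>\<^sub>\<complex> ('x \<times> 'a)) set" where
  "linking_algebra act ip = {linking_op act ip T x y a | T x y a. T \<in> compact_ops act ip}"

text \<open>
  The inner product of the Hilbert module \<open>X \<oplus> A\<close>. The norm it induces is equivalent, but in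
  general not equal, to the norm of the product type; only the algebra structure of the linking
  algebra is used, which is composition and the adjoint with respect to this inner product.
\<close>

definition ip_sum :: "('x \<Rightarrow> 'x \<Rightarrow> 'a::cstar_algebra) \<Rightarrow> 'x \<times> 'a \<Rightarrow> 'x \<times> 'a \<Rightarrow> 'a" where
  "ip_sum ip u v = ip (fst u) (fst v) + star (snd u) * snd v"

definition linking_star :: "('x::complex_banach \<Rightarrow> 'x \<Rightarrow> 'a::cstar_algebra)
    \<Rightarrow> ('x \<times> 'a) \<Rightarrow>\<^sub>\<complex> ('x \<times> 'a) \<Rightarrow> ('x \<times> 'a) \<Rightarrow>\<^sub>\<complex> ('x \<times> 'a)" where
  "linking_star ip = adj_wrt (ip_sum ip) (ip_sum ip)"

context hilbert_module
begin

lemma ip_add_left: "ip (x + y) z = ip x z + ip y z"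
  by (metis ip_commute ip_add_right star_add)

lemma ip_scaleC_left: "ip (c *\<^sub>C x) z = cnj c *\<^sub>C ip x z"
  by (metis ip_commute ip_scaleC_right star_scaleC)

lemma norm_ip_self: "norm (ip x x) = (norm x)\<^sup>2"
  by (simp add: norm_eq)

lemma norm_star: "norm (star a) = norm (a :: 'a)"
proof -
  have "norm b \<le> norm (star b)" for b :: 'a
  proof (cases "b = 0")
    case False
    have "norm b * norm b \<le> norm (star b) * norm b"
      using norm_mult_ineq[of "star b" b] by (simp add: cstar_identity power2_eq_square)
    with False show ?thesis by simp
  qed simp
  from this[of a] this[of "star a"] show ?thesis by (simp add: star_star)
qed

lemma norm_act_le: "norm (act x a) \<le> norm x * norm a"
proof -
  have "ip (act x a) (act x a) = star a * ip x x * a"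
    by (metis ip_act_right ip_commute mult.assoc star_mult)
  then have "(norm (act x a))\<^sup>2 = norm (star a * ip x x * a)"
    by (metis norm_ip_self)
  also have "\<dots> \<le> norm (star a) * norm (ip x x) * norm a"
    by (meson norm_mult_ineq mult_right_mono norm_ge_zero order_trans)
  also have "\<dots> = (norm x * norm a)\<^sup>2"
    by (simp add: norm_star norm_ip_self power2_eq_square)
  finally show ?thesis
    by (rule power2_le_imp_le) simp
qed

text \<open>By polarization; the optimal constant is not needed here.\<close>

lemma norm_ip_le: "norm (ip y z) \<le> norm z * (4 * norm y)"
proof (cases "y = 0 \<or> z = 0")
  case True
  have "ip 0 z = 0" "ip y 0 = 0"
    using ip_scaleC_left[of 0 0 z] ip_scaleC_right[of y 0 0] by simp_all
  with True show ?thesis by auto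
next
  case False
  have *: "norm (ip u v) \<le> 4" if "norm u = 1" "norm v = 1" for u v
  proof -
    have ex: "ip (u + d *\<^sub>C v) (u + d *\<^sub>C v)
        = ip u u + d *\<^sub>C ip u v + cnj d *\<^sub>C ip v u + (cnj d * d) *\<^sub>C ip v v" for d
      by (simp add: ip_add_left ip_add_right ip_scaleC_left ip_scaleC_right scaleC_add_right
          scaleC_scaleC add_ac mult.commute)
    have "4 *\<^sub>C ip u v = (1 + 1 + 1 + 1) *\<^sub>C ip u v" by simp
    then have four: "4 *\<^sub>C ip u v = ip u v + ip u v + ip u v + ip u v"
      by (simp only: scaleC_add_left scaleC_one)
    have pol: "4 *\<^sub>C ip u v = 1 *\<^sub>C ip (u + 1 *\<^sub>C v) (u + 1 *\<^sub>C v)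
        + (- 1) *\<^sub>C ip (u + (- 1) *\<^sub>C v) (u + (- 1) *\<^sub>C v)
        + (- \<i>) *\<^sub>C ip (u + \<i> *\<^sub>C v) (u + \<i> *\<^sub>C v)
        + \<i> *\<^sub>C ip (u + (- \<i>) *\<^sub>C v) (u + (- \<i>) *\<^sub>C v)"
      (is "_ = ?a + ?b + ?c + ?d")
      unfolding ex by (simp add: four scaleC_add_right scaleC_add_left scaleC_scaleC scaleC_one
          complex_vector.scale_right_diff_distrib)
    have bd: "norm (c *\<^sub>C ip (u + d *\<^sub>C v) (u + d *\<^sub>C v)) \<le> 4" if "cmod c = 1" "cmod d = 1" for c d
    proof -
      have "norm (u + d *\<^sub>C v) \<le> 2"
        using norm_triangle_ineq[of u "d *\<^sub>C v"] that \<open>norm u = 1\<close> \<open>norm v = 1\<close>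
        by (simp add: norm_scaleC)
      then have "(norm (u + d *\<^sub>C v))\<^sup>2 \<le> 2\<^sup>2" by (rule power_mono) simp
      then show ?thesis using that by (simp add: norm_scaleC norm_ip_self)
    qed
    have "norm (4 *\<^sub>C ip u v) \<le> norm ?a + norm ?b + norm ?c + norm ?d"
      unfolding pol by (intro norm_triangle_mono order_refl)
    also have "\<dots> \<le> 4 + 4 + 4 + 4"
      using bd[of 1 1] bd[of "- 1" "- 1"] bd[of "- \<i>" \<i>] bd[of \<i> "- \<i>"]
      by (intro add_mono) (simp_all only: norm_one norm_minus_cancel norm_ii)
    finally show ?thesis by (simp add: norm_scaleC)
  qed
  let ?u = "complex_of_real (inverse (norm y)) *\<^sub>C y"
  let ?v = "complex_of_real (inverse (norm z)) *\<^sub>C z"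
  have "norm (ip ?u ?v) \<le> 4"
    using False by (intro *) (simp_all add: norm_scaleC norm_inverse)
  moreover have "norm (ip ?u ?v) = norm (ip y z) / (norm y * norm z)"
    by (simp add: ip_scaleC_left ip_scaleC_right scaleC_scaleC norm_scaleC norm_mult norm_inverse
        divide_inverse mult_ac)
  ultimately show ?thesis
    using False by (simp add: pos_divide_le_eq mult_ac)
qed

lemma bounded_clinearI:
  fixes f :: "'u::complex_normed_vector \<Rightarrow> 'v::complex_normed_vector"
  assumes "\<And>u v. f (u + v) = f u + f v" "\<And>c u. f (c *\<^sub>C u) = c *\<^sub>C f u" "\<And>u. norm (f u) \<le> norm u * K"
  shows "bounded_clinear f"
  unfolding bounded_clinear_def
proof
  show "bounded_linear f"
    by (rule bounded_linear_intro[of _ K]) (simp_all add: assms scaleC_of_real[symmetric])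
qed (simp add: assms)

lemma ket_op_apply [simp]: "clop_apply (ket_op act x) a = act x a"
  unfolding ket_op_def
  by (subst Clop_apply, rule bounded_clinearI[of _ "norm x"])
    (use norm_act_le in \<open>simp_all add: act_add_right act_scaleC_right mult.commute\<close>)

lemma bra_op_apply [simp]: "clop_apply (bra_op ip y) z = ip y z"
  unfolding bra_op_def
  by (subst Clop_apply, rule bounded_clinearI[of _ "4 * norm y"])
    (use norm_ip_le in \<open>simp_all add: ip_add_right ip_scaleC_right\<close>)

lemma lmult_op_apply [simp]: "clop_apply (lmult_op a) b = (a :: 'a) * b"
  unfolding lmult_op_def
  by (subst Clop_apply, rule bounded_clinearI[of _ "norm a"])
    (use norm_mult_ineq[of a] in \<open>simp_all add: distrib_left mult_scaleC_right mult.commute\<close>)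

lemma theta_eq: "theta act ip x y = ket_op act x o\<^sub>C bra_op ip y"
proof -
  have "(\<lambda>z. act x (ip y z)) = clop_apply (ket_op act x o\<^sub>C bra_op ip y)"
    by (auto simp: clop_compose.rep_eq)
  then show ?thesis by (simp add: theta_def clop_apply_inverse)
qed

lemma theta_apply [simp]: "clop_apply (theta act ip x y) z = act x (ip y z)"
  by (simp add: theta_eq clop_compose.rep_eq)

lemma linking_op_apply:
  "clop_apply (linking_op act ip T x y a) (z, b) = (clop_apply T z + act x b, ip y z + a * b)"
  by (simp add: linking_op_def block_op.rep_eq)

text \<open>So the entries of an element of the linking algebra are well defined.\<close>

lemma linking_op_inject:
  assumes "linking_op act ip T x y a = linking_op act ip S u v b"
  shows "T = S \<and> x = u \<and> y = v \<and> a = b"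
proof -
  have e: "(clop_apply T z + act x c, ip y z + a * c) = (clop_apply S z + act u c, ip v z + b * c)" for z c
    by (metis assms linking_op_apply)
  have z0: "clop_apply R 0 = 0" for R :: "'x \<Rightarrow>\<^sub>\<complex> 'x"
    using clop_apply[of R] by (auto simp: bounded_clinear_def intro: linear_0 bounded_linear.linear)
  have ip0: "ip w 0 = 0" for w
    using ip_scaleC_right[of w 0 0] by simp
  have act0: "act w 0 = 0" for w
    using act_scaleC_right[of w 0 0] by simp
  have ipx: "w = 0" if "ip w w = 0" for w
    using that norm_eq[of w] by simp
  have "T = S"
    by (rule clop_eqI) (use e[of _ 0] in \<open>simp add: act0\<close>)
  have "ip (y - v) z = 0" for z
    using e[of z 0] ip_add_left[of "y - v" v z] by simp
  then have "y = v" using ipx[of "y - v"] by simp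
  have ac: "(a - b) * c = 0" for c
    using e[of 0 c] by (simp add: ip0 left_diff_distrib)
  have "norm (star (star (a - b)) * star (a - b)) = 0"
    using ac by (simp add: star_star)
  then have "norm (a - b) = 0"
    by (simp only: cstar_identity norm_star) simp
  then have "a = b" by simp
  have xc: "act (x - u) c = 0" for c
    using e[of 0 c] act_add_left[of "x - u" u c] by (simp add: z0)
  have "ip (x - u) (x - u) * ip (x - u) (x - u) = 0"
    by (metis ip_act_right xc ip0)
  then have "(norm (ip (x - u) (x - u)))\<^sup>2 = 0"
    by (metis cstar_identity ip_commute norm_zero)
  then have "x = u" using ipx[of "x - u"] by simp
  show ?thesis using \<open>T = S\<close> \<open>x = u\<close> \<open>y = v\<close> \<open>a = b\<close> by simp
qed

end

section \<open>Operator-valued maps on Hilbert modules\<close>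

definition phi_map :: "('x \<Rightarrow> 'x \<Rightarrow> 'a) \<Rightarrow> ('a \<Rightarrow> 'h::complex_hilbert \<Rightarrow>\<^sub>\<complex> 'h)
    \<Rightarrow> ('x \<Rightarrow> 'h \<Rightarrow>\<^sub>\<complex> 'k::complex_hilbert) \<Rightarrow> bool" where
  "phi_map ip \<phi> \<Phi> \<longleftrightarrow> (\<forall>x y. adj (\<Phi> x) o\<^sub>C \<Phi> y = \<phi> (ip x y))"

text \<open>
  The Hilbert spaces of a Stinespring representation are types here, so they cannot be chosen inside
  a definition: whatever is defined from a minimal Stinespring representation takes it as an argument.
  The letter \<open>\<Xi>\<close> stands for the usual capital pi, which is a reserved binder.
\<close>

definition minimal_stinespring ::
  "('x \<Rightarrow> 'x \<Rightarrow> 'a::cstar_algebra) \<Rightarrow> ('a \<Rightarrow> 'h::complex_hilbert \<Rightarrow>\<^sub>\<complex> 'h)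
    \<Rightarrow> ('x \<Rightarrow> 'h \<Rightarrow>\<^sub>\<complex> 'k::complex_hilbert)
    \<Rightarrow> ('a \<Rightarrow> 'h1::complex_hilbert \<Rightarrow>\<^sub>\<complex> 'h1) \<Rightarrow> ('x \<Rightarrow> 'h1 \<Rightarrow>\<^sub>\<complex> 'k1::complex_hilbert)
    \<Rightarrow> 'h \<Rightarrow>\<^sub>\<complex> 'h1 \<Rightarrow> 'k \<Rightarrow>\<^sub>\<complex> 'k1 \<Rightarrow> bool" where
  "minimal_stinespring ip \<phi> \<Phi> \<pi> \<Xi> V W \<longleftrightarrow>
    star_rep UNIV (*) star \<pi> \<and>
    phi_map ip \<pi> \<Xi> \<and>
    W o\<^sub>C adj W = clop_id \<and>
    (\<forall>a. \<phi> a = adj V o\<^sub>C \<pi> a o\<^sub>C V) \<and>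
    closure (cspan {\<pi> a (V h) | a h. True}) = UNIV \<and>
    (\<forall>x. \<Phi> x = adj W o\<^sub>C \<Xi> x o\<^sub>C V) \<and>
    closure (cspan {\<Xi> x (V h) | x h. True}) = UNIV"

text \<open>
  The representation of \<open>K(X)\<close> on \<open>K\<close> determined by a minimal Stinespring representation; the
  requirement of extensionality only fixes its values outside of \<open>K(X)\<close>.
\<close>

definition compact_rep :: "('x::complex_banach \<Rightarrow> 'a::cstar_algebra \<Rightarrow> 'x) \<Rightarrow> ('x \<Rightarrow> 'x \<Rightarrow> 'a)
    \<Rightarrow> ('x \<Rightarrow> 'h1::complex_hilbert \<Rightarrow>\<^sub>\<complex> 'k1::complex_hilbert) \<Rightarrow> 'k::complex_hilbert \<Rightarrow>\<^sub>\<complex> 'k1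
    \<Rightarrow> 'x \<Rightarrow>\<^sub>\<complex> 'x \<Rightarrow> 'k \<Rightarrow>\<^sub>\<complex> 'k" where
  "compact_rep act ip \<Xi> W =
    (THE \<rho>. \<rho> \<in> extensional (compact_ops act ip) \<and>
      star_rep (compact_ops act ip) (o\<^sub>C) (adj_wrt ip ip) \<rho> \<and>
      (\<forall>x y. \<rho> (theta act ip x y) = adj W o\<^sub>C \<Xi> x o\<^sub>C adj (\<Xi> y) o\<^sub>C W))"

definition linking_map :: "('x::complex_banach \<Rightarrow> 'a::cstar_algebra \<Rightarrow> 'x) \<Rightarrow> ('x \<Rightarrow> 'x \<Rightarrow> 'a)
    \<Rightarrow> ('a \<Rightarrow> 'h::complex_hilbert \<Rightarrow>\<^sub>\<complex> 'h) \<Rightarrow> ('x \<Rightarrow> 'h \<Rightarrow>\<^sub>\<complex> 'k::complex_hilbert)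
    \<Rightarrow> ('x \<Rightarrow> 'h1::complex_hilbert \<Rightarrow>\<^sub>\<complex> 'k1::complex_hilbert) \<Rightarrow> 'k \<Rightarrow>\<^sub>\<complex> 'k1
    \<Rightarrow> ('x \<times> 'a) \<Rightarrow>\<^sub>\<complex> ('x \<times> 'a) \<Rightarrow> ('k \<times> 'h) \<Rightarrow>\<^sub>\<complex> ('k \<times> 'h)" where
  "linking_map act ip \<phi> \<Phi> \<Xi> W R =
    (THE S. \<exists>T x y a. T \<in> compact_ops act ip \<and> R = linking_op act ip T x y a \<and>
      S = block_op (compact_rep act ip \<Xi> W T) (\<Phi> x) (adj (\<Phi> y)) (\<phi> a))"

lemma (in hilbert_module) linking_map_linking_op:
  assumes "T \<in> compact_ops act ip"
  shows "linking_map act ip \<phi> \<Phi> \<Xi> W (linking_op act ip T x y a) =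
    block_op (compact_rep act ip \<Xi> W T) (\<Phi> x) (adj (\<Phi> y)) (\<phi> a)"
  unfolding linking_map_def
  by (rule the_equality) (use assms linking_op_inject in blast)+

end

theory Submission
  imports Defs
begin

text \<open>
  Only the closed subspace of \<open>K\<close> spanned by the vectors \<open>\<Phi> x h\<close> enters the linking map of \<open>\<Phi>\<close>, and this subspace
  depends only on \<open>\<phi>\<close>: the inner product of \<open>\<Phi> x h\<close> and \<open>\<Phi> y g\<close> is \<open>\<langle>h, \<phi> \<langle>x, y\<rangle> g\<rangle>\<close>. On it the
  representation of \<open>K(X)\<close> acts by \<open>\<Phi> x h \<mapsto> \<Phi> (T x) h\<close>, and it vanishes on the orthogonal
  complement. So \<open>\<Phi> x h \<mapsto> \<Psi> x h\<close> defines a partial isometry \<open>Z\<close>, and conjugation by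
  \<open>Y = Z \<oplus> 1\<close> takes the linking map of \<open>\<Phi>\<close> to that of \<open>\<Psi>\<close> (\<open>linking_map_transport\<close>); conjugation
  by \<open>Y*\<close> takes it back. As \<open>Y* Y\<close> is a unit for all values of the first map, conjugation respects
  products of these values and their adjoints. Hence the identities that define the two domains hold
  for one map exactly if they hold for the other (\<open>domains_transport\<close>).

  In terms of minimal Stinespring representations, \<open>Z = W2* U W1\<close>, where the unitary \<open>U\<close> takes
  \<open>\<Xi>1 x (V1 h)\<close> to \<open>\<Xi>2 x (V2 h)\<close>: both families are total and have the same Gram kernel
  (\<open>unitary_of_total_families\<close>). The representation of \<open>K(X)\<close> is \<open>W* \<sigma>(T) W\<close>, where \<open>\<sigma>(T)\<close> takes
  \<open>\<Xi> x (V h)\<close> to \<open>\<Xi> (T x) (V h)\<close> (\<open>compact_rep_eq\<close>). Two points of this need analysis. That \<open>\<sigma>(T)\<close> is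
  bounded follows from Cauchy-Schwarz and the bound on \<open>\<Xi>\<close>, both applied to the powers of \<open>T* T\<close>
  (\<open>lincomb_moment_bound\<close>). That the values on the \<open>\<theta>\<close>-operators determine a *-representation of
  \<open>K(X)\<close> follows from automatic continuity (\<open>star_rep_norm_le\<close>), which is proved with a Neumann
  series and also bounds \<open>\<pi>\<close> and hence \<open>\<Xi>\<close>.
\<close>

section \<open>Adjoints of bounded operators on Hilbert spaces\<close>

lemma cinner_zero_right [simp]: "cinner x 0 = 0"
  using cinner_scaleC_right[of x 0 0] by simp

lemma cinner_zero_left [simp]: "cinner 0 x = 0"
  using cinner_commute[of 0 x] by simp

lemma cinner_add_left: "cinner (x + y) z = cinner x z + cinner y z"
  by (metis cinner_add_right cinner_commute complex_cnj_add)

lemma cinner_scaleC_left: "cinner (c *\<^sub>C x) z = cnj c * cinner x z"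
  by (metis cinner_scaleC_right cinner_commute complex_cnj_mult)

lemma cinner_scaleR_right: "cinner x (r *\<^sub>R y) = of_real r * cinner x y"
  by (metis cinner_scaleC_right scaleC_of_real)

lemma cinner_scaleR_left: "cinner (r *\<^sub>R x) y = of_real r * cinner x y"
  by (metis cinner_scaleC_left scaleC_of_real complex_cnj_complex_of_real)

lemma cinner_minus_right: "cinner x (- y) = - cinner x y"
  using cinner_scaleR_right[of x "- 1" y] by simp

lemma cinner_minus_left: "cinner (- x) y = - cinner x y"
  using cinner_scaleR_left[of "- 1" x y] by simp

lemma cinner_diff_right: "cinner x (y - z) = cinner x y - cinner x z"
  using cinner_add_right[of x y "- z"] by (simp add: cinner_minus_right)

lemma cinner_diff_left: "cinner (x - y) z = cinner x z - cinner y z"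
  using cinner_add_left[of x "- y" z] by (simp add: cinner_minus_left)

lemmas cinner_linear = cinner_add_left cinner_add_right cinner_diff_left cinner_diff_right
  cinner_scaleC_left cinner_scaleC_right cinner_scaleR_left cinner_scaleR_right

lemma cinner_eq_0_iff: "cinner x x = 0 \<longleftrightarrow> x = 0"
  by (simp add: cinner_norm)

lemma Re_cinner_commute: "Re (cinner x y) = Re (cinner y x)"
  using cinner_commute[of x y] by simp

lemma norm_power2_cinner: "(norm x)\<^sup>2 = Re (cinner x x)"
  by (simp add: cinner_norm)

lemma norm_add_power2: "(norm (x + y))\<^sup>2 = (norm x)\<^sup>2 + (norm y)\<^sup>2 + 2 * Re (cinner x y)"
  for x y :: "'a::complex_hilbert"
  by (simp add: norm_power2_cinner cinner_linear Re_cinner_commute[of y x])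

lemma norm_diff_power2: "(norm (x - y))\<^sup>2 = (norm x)\<^sup>2 + (norm y)\<^sup>2 - 2 * Re (cinner x y)"
  for x y :: "'a::complex_hilbert"
  by (simp add: norm_power2_cinner cinner_linear Re_cinner_commute[of y x])

lemma cinner_Cauchy_Schwarz: "cmod (cinner x y) \<le> norm x * norm y"
proof (cases "x = 0")
  case False
  \<comment> \<open>the component of \<open>y\<close> orthogonal to \<open>x\<close>, scaled to avoid a division\<close>
  define z where "z = (norm x)\<^sup>2 *\<^sub>R y - cinner x y *\<^sub>C x"
  have yx: "cinner y x = cnj (cinner x y)" by (rule cinner_commute)
  have "(norm z)\<^sup>2 = (norm x)\<^sup>2 * ((norm x)\<^sup>2 * (norm y)\<^sup>2 - (cmod (cinner x y))\<^sup>2)"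
    unfolding norm_power2_cinner[of z] unfolding z_def cmod_power2
    by (simp only: cinner_linear yx) (simp add: cinner_norm algebra_simps power2_eq_square)
  then have "0 \<le> (norm x)\<^sup>2 * ((norm x)\<^sup>2 * (norm y)\<^sup>2 - (cmod (cinner x y))\<^sup>2)"
    by (metis zero_le_power2)
  with False have "(cmod (cinner x y))\<^sup>2 \<le> (norm x * norm y)\<^sup>2"
    by (simp add: zero_le_mult_iff power_mult_distrib)
  then show ?thesis by (rule power2_le_imp_le) simp
qed simp

lemma bounded_linear_cinner_right: "bounded_linear (cinner x)"
  by (rule bounded_linear_intro[of _ "norm x"])
    (use cinner_Cauchy_Schwarz[of x] in \<open>simp_all add: cinner_linear scaleR_conv_of_real mult.commute\<close>)

lemma continuous_on_cinner_right [continuous_intros]: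
  "continuous_on S f \<Longrightarrow> continuous_on S (\<lambda>t. cinner x (f t))"
  by (rule bounded_linear.continuous_on[OF bounded_linear_cinner_right])

lemma cinner_ext:
  assumes "\<And>x. cinner x y = cinner x z"
  shows "y = z"
proof -
  have "cinner (y - z) (y - z) = 0" using assms[of "y - z"] by (simp add: cinner_diff_right)
  then show ?thesis by (simp add: cinner_eq_0_iff)
qed

lemma cinner_ext_dense:
  assumes "closure (cspan S) = UNIV" and eq: "\<And>x. x \<in> S \<Longrightarrow> cinner x y = cinner x z"
  shows "y = z"
proof -
  have sub: "complex_vector.subspace {x. cinner (y - z) x = 0}"
    by (auto simp: complex_vector.subspace_def cinner_linear)
  have "S \<subseteq> {x. cinner (y - z) x = 0}"
    using eq by (auto simp: cinner_linear cinner_commute[of y] cinner_commute[of z])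
  then have "cspan S \<subseteq> {x. cinner (y - z) x = 0}"
    using sub by (rule complex_vector.span_minimal)
  moreover have "closed {x. cinner (y - z) x = 0}"
    by (intro closed_Collect_eq continuous_intros)
  ultimately have "closure (cspan S) \<subseteq> {x. cinner (y - z) x = 0}"
    by (rule closure_minimal)
  then have "cinner (y - z) (y - z) = 0" using assms(1) by blast
  then show ?thesis by (simp add: cinner_eq_0_iff)
qed

text \<open>
  The representing vector is the minimizer of the strictly convex functional
  \<open>J x = \<parallel>x\<parallel>\<^sup>2 - 2 Re (f x)\<close>, which is bounded below; by the parallelogram law
  every minimizing sequence of \<open>J\<close> is Cauchy.
\<close>

lemma riesz_representation:
  fixes f :: "'a::complex_hilbert \<Rightarrow> complex"
  assumes bl: "bounded_linear f" and cl: "\<And>c x. f (c *\<^sub>C x) = c * f x"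
  obtains y where "\<And>x. f x = cinner y x"
proof -
  interpret bounded_linear f by (rule bl)
  define J where "J x = (norm x)\<^sup>2 - 2 * Re (f x)" for x
  obtain K where K: "\<And>x. norm (f x) \<le> norm x * K" using bounded by blast
  have low: "- K\<^sup>2 \<le> J x" for x
  proof -
    have "2 * Re (f x) \<le> 2 * (norm x * K)" using complex_Re_le_cmod[of "f x"] K[of x] by linarith
    moreover have "0 \<le> (norm x - K)\<^sup>2" by simp
    ultimately show ?thesis by (simp add: J_def power2_diff)
  qed
  define m where "m = Inf (range J)"
  have bdd: "bdd_below (range J)" using low by (intro bdd_belowI) blast
  have m: "m \<le> J x" for x unfolding m_def by (rule cInf_lower[OF _ bdd]) simp
  have "\<exists>x. J x < m + inverse (real (Suc n))" for n
    using cInf_lessD[of "range J" "m + inverse (real (Suc n))"] by (auto simp: m_def)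
  then obtain X where X: "\<And>n. J (X n) < m + inverse (real (Suc n))" by metis
  have par: "(norm (x - y))\<^sup>2 = 2 * J x + 2 * J y - 4 * J ((1/2) *\<^sub>R (x + y))" for x y
  proof -
    have "4 * (norm ((1/2) *\<^sub>R (x + y)))\<^sup>2 = (norm (x + y))\<^sup>2"
      by (simp add: power_mult_distrib power_divide)
    moreover have "f ((1/2) *\<^sub>R (x + y)) = (1/2) *\<^sub>R (f x + f y)" by (simp only: scaleR add)
    ultimately show ?thesis
      by (simp add: J_def norm_add_power2 norm_diff_power2 add_divide_distrib)
  qed
  have dist: "(norm (X i - X j))\<^sup>2 < 2 * inverse (real (Suc i)) + 2 * inverse (real (Suc j))" for i j
    using par[of "X i" "X j"] X[of i] X[of j] m[of "(1/2) *\<^sub>R (X i + X j)"] by linarith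
  have "Cauchy X"
  proof (rule CauchyI)
    fix e :: real assume "0 < e"
    then have "0 < e\<^sup>2 / 4" by simp
    then obtain N where N: "inverse (real (Suc N)) < e\<^sup>2 / 4" using reals_Archimedean by blast
    have inv: "inverse (real (Suc i)) < e\<^sup>2 / 4" if "i \<ge> N" for i
    proof -
      have "inverse (real (Suc i)) \<le> inverse (real (Suc N))"
        using that by (intro le_imp_inverse_le) auto
      with N show ?thesis by linarith
    qed
    show "\<exists>M. \<forall>i\<ge>M. \<forall>j\<ge>M. norm (X i - X j) < e"
    proof (intro exI allI impI)
      fix i j assume "N \<le> i" "N \<le> j"
      then have "(norm (X i - X j))\<^sup>2 < e\<^sup>2" using dist[of i j] inv[of i] inv[of j] by linarith
      then show "norm (X i - X j) < e" using \<open>0 < e\<close> by (auto intro: power2_less_imp_less)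
    qed
  qed
  then obtain y where y: "X \<longlonglongrightarrow> y" using Cauchy_convergent_iff convergent_def by blast
  have "(\<lambda>n. J (X n)) \<longlonglongrightarrow> J y"
    unfolding J_def by (intro tendsto_intros y tendsto)
  moreover have "(\<lambda>n. m + inverse (real (Suc n))) \<longlonglongrightarrow> m + 0"
    by (intro tendsto_intros LIMSEQ_inverse_real_of_nat)
  ultimately have "J y \<le> m"
    using X by (intro LIMSEQ_le[of "\<lambda>n. J (X n)" _ "\<lambda>n. m + inverse (real (Suc n))"]) (auto intro: less_imp_le)
  then have min: "J y \<le> J x" for x using m[of x] by linarith
  have Re_eq: "Re (f x) = Re (cinner y x)" for x
  proof -
    define b where "b = Re (cinner y x) - Re (f x)"
    define d where "d = 1 / ((norm x)\<^sup>2 + 1)"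
    have pos: "(norm x)\<^sup>2 + 1 > 0" by (simp add: add_nonneg_pos)
    have step: "J (y + t *\<^sub>R x) = J y + t\<^sup>2 * (norm x)\<^sup>2 + 2 * t * b" for t
      by (simp add: J_def norm_add_power2 add scaleR cinner_linear b_def power_mult_distrib algebra_simps)
    \<comment> \<open>a step in the direction of steepest descent, so short that the linear term dominates\<close>
    have "J y \<le> J (y + (- b * d) *\<^sub>R x)" by (rule min)
    also have "\<dots> = J y + (b * d)\<^sup>2 * (norm x)\<^sup>2 - 2 * b * d * b"
      unfolding step by simp
    finally have "2 * d * b\<^sup>2 \<le> b\<^sup>2 * d * (d * (norm x)\<^sup>2)" by (simp add: power2_eq_square algebra_simps)
    also have "\<dots> \<le> b\<^sup>2 * d * 1"
      using pos by (intro mult_left_mono) (auto simp: d_def divide_simps)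
    finally have "d * b\<^sup>2 \<le> 0" by simp
    then have "b\<^sup>2 \<le> 0" using pos by (simp add: d_def mult_le_0_iff divide_le_0_iff)
    then show ?thesis by (simp add: b_def)
  qed
  have "f x = cinner y x" for x
  proof -
    have "Im (f x) = Im (cinner y x)"
      using Re_eq[of "\<i> *\<^sub>C x"] by (simp add: cl cinner_scaleC_right)
    with Re_eq[of x] show ?thesis by (simp add: complex_eq_iff)
  qed
  then show thesis by (rule that)
qed

lemma bounded_linear_clop: "bounded_linear (clop_apply T)"
  using clop_apply[of T] by (simp add: bounded_clinear_def)

lemma clop_scaleC: "clop_apply T (c *\<^sub>C x) = c *\<^sub>C clop_apply T x"
  using clop_apply[of T] by (simp add: bounded_clinear_def)

lemmas clop_add = linear_add[OF bounded_linear.linear[OF bounded_linear_clop]]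
lemmas clop_diff = linear_diff[OF bounded_linear.linear[OF bounded_linear_clop]]
lemmas clop_zero [simp] = linear_0[OF bounded_linear.linear[OF bounded_linear_clop]]

lemma norm_clop_apply: "norm (clop_apply T x) \<le> norm T * norm x"
  unfolding norm_clop.rep_eq by (rule onorm[OF bounded_linear_clop])

lemma norm_clop_le: "0 \<le> b \<Longrightarrow> (\<And>x. norm (clop_apply T x) \<le> b * norm x) \<Longrightarrow> norm T \<le> b"
  unfolding norm_clop.rep_eq by (rule onorm_bound)

lemma bounded_clinear_intro:
  fixes f :: "'a::complex_normed_vector \<Rightarrow> 'b::complex_normed_vector"
  assumes "\<And>x y. f (x + y) = f x + f y" "\<And>c x. f (c *\<^sub>C x) = c *\<^sub>C f x" "\<And>x. norm (f x) \<le> norm x * K"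
  shows "bounded_clinear f"
  unfolding bounded_clinear_def
  by (auto intro!: bounded_linear_intro[of _ K] simp: assms scaleC_of_real[symmetric])

lemma adj_wrt_unique:
  assumes "\<And>x y. ipb (clop_apply T x) y = ipa x (clop_apply S y)"
    and "\<And>y z. (\<And>x. ipa x y = ipa x z) \<Longrightarrow> y = z"
  shows "adj_wrt ipa ipb T = S"
  unfolding adj_wrt_def
proof (rule the_equality)
  fix R assume R: "\<forall>x y. ipb (clop_apply T x) y = ipa x (clop_apply R y)"
  show "R = S"
    by (rule clop_eqI, rule assms(2)) (metis R assms(1))
qed (use assms in blast)

lemma adj_eqI:
  assumes "\<And>x y. cinner (clop_apply T x) y = cinner x (clop_apply S y)"
  shows "adj T = S"
  unfolding adj_def by (rule adj_wrt_unique) (fact assms, rule cinner_ext)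

text \<open>\<open>adj T y\<close> represents the functional \<open>x \<mapsto> \<langle>y, T x\<rangle>\<close>.\<close>

lemma cinner_adj: "cinner (clop_apply T x) y = cinner x (clop_apply (adj T) y)"
proof -
  have "\<exists>z. \<forall>x. cinner (clop_apply T x) y = cinner x z" for y
  proof -
    have "bounded_linear (\<lambda>x. cinner y (clop_apply T x))"
      by (rule bounded_linear_compose[OF bounded_linear_cinner_right bounded_linear_clop])
    then obtain z where "\<And>x. cinner y (clop_apply T x) = cinner z x"
      by (rule riesz_representation) (simp_all add: clop_scaleC cinner_scaleC_right)
    then show ?thesis by (metis cinner_commute)
  qed
  then obtain S where S: "\<And>x y. cinner (clop_apply T x) y = cinner x (S y)" by metis
  have "bounded_clinear S"
  proof (rule bounded_clinear_intro[of _ "norm T"])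
    show "S (y + z) = S y + S z" for y z by (rule cinner_ext) (simp add: S[symmetric] cinner_add_right)
    show "S (c *\<^sub>C y) = c *\<^sub>C S y" for c y
      by (rule cinner_ext) (simp add: S[symmetric] cinner_scaleC_right)
    show "norm (S y) \<le> norm y * norm T" for y
    proof (cases "S y = 0")
      case False
      have "(norm (S y))\<^sup>2 = cmod (cinner (clop_apply T (S y)) y)"
        by (simp add: S cinner_norm norm_power)
      also have "\<dots> \<le> norm T * norm (S y) * norm y"
        by (meson cinner_Cauchy_Schwarz norm_clop_apply mult_right_mono norm_ge_zero order_trans)
      finally show ?thesis using False by (simp add: power2_eq_square mult_ac)
    qed simp
  qed
  then have "clop_apply (Clop S) = S" by (rule Clop_apply)
  then have "adj T = Clop S" using S by (intro adj_eqI) simp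
  then show ?thesis using S \<open>clop_apply (Clop S) = S\<close> by simp
qed

lemma cinner_adj_left: "cinner (clop_apply (adj T) x) y = cinner x (clop_apply T y)"
  using cinner_adj[of T y x] cinner_commute by metis

lemma clop_compose_apply [simp]: "clop_apply (S o\<^sub>C T) x = clop_apply S (clop_apply T x)"
  by (simp add: clop_compose.rep_eq)

lemma clop_id_apply [simp]: "clop_apply clop_id x = x"
  by (simp add: clop_id.rep_eq)

lemma adj_adj [simp]: "adj (adj T) = T"
  by (rule adj_eqI) (rule cinner_adj_left)

lemma adj_compose [simp]: "adj (S o\<^sub>C T) = adj T o\<^sub>C adj S"
  by (rule adj_eqI) (simp add: cinner_adj)

lemma adj_id [simp]: "adj clop_id = clop_id"
  by (rule adj_eqI) simp

lemma clop_compose_assoc: "(R o\<^sub>C S) o\<^sub>C T = R o\<^sub>C (S o\<^sub>C T)"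
  by (rule clop_eqI) simp

lemma norm_adj_le: "norm (adj T) \<le> norm T"
proof (rule norm_clop_le)
  fix y show "norm (clop_apply (adj T) y) \<le> norm T * norm y"
  proof (cases "clop_apply (adj T) y = 0")
    case False
    have "(norm (clop_apply (adj T) y))\<^sup>2 = cmod (cinner (clop_apply T (clop_apply (adj T) y)) y)"
      by (simp add: cinner_adj cinner_norm norm_power)
    also have "\<dots> \<le> norm T * norm (clop_apply (adj T) y) * norm y"
      by (meson cinner_Cauchy_Schwarz norm_clop_apply mult_right_mono norm_ge_zero order_trans)
    finally show ?thesis using False by (simp add: power2_eq_square mult_ac)
  qed simp
qed simp

section \<open>Completeness of the space of operators, and extension from dense subspaces\<close>

text \<open>
  The space of bounded real-linear operators is complete, and complex linearity survives
  pointwise limits.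
\<close>

lemma clop_Cauchy_convergent:
  fixes X :: "nat \<Rightarrow> ('a::complex_normed_vector \<Rightarrow>\<^sub>\<complex> 'b::complex_banach)"
  assumes "Cauchy X"
  shows "convergent X"
proof -
  have bf: "blinfun_apply (Blinfun (clop_apply T)) = clop_apply T" for T :: "'a \<Rightarrow>\<^sub>\<complex> 'b"
    by (rule bounded_linear_Blinfun_apply[OF bounded_linear_clop])
  have nd: "norm (Blinfun (clop_apply S) - Blinfun (clop_apply T)) = norm (S - T)" for S T :: "'a \<Rightarrow>\<^sub>\<complex> 'b"
    by (simp add: norm_blinfun.rep_eq norm_clop.rep_eq minus_blinfun.rep_eq minus_clop.rep_eq bf)
  have "Cauchy (\<lambda>n. Blinfun (clop_apply (X n)))"
    using assms by (simp add: Cauchy_def dist_norm nd)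
  then obtain L where L: "(\<lambda>n. Blinfun (clop_apply (X n))) \<longlonglongrightarrow> L"
    using Cauchy_convergent_iff convergent_def by blast
  have pt: "(\<lambda>n. clop_apply (X n) x) \<longlonglongrightarrow> blinfun_apply L x" for x
    using blinfun.tendsto[OF L tendsto_const[of x]] by (simp add: bf)
  have "blinfun_apply L (c *\<^sub>C x) = c *\<^sub>C blinfun_apply L x" for c x
  proof (rule LIMSEQ_unique[OF pt])
    show "(\<lambda>n. clop_apply (X n) (c *\<^sub>C x)) \<longlonglongrightarrow> c *\<^sub>C blinfun_apply L x"
      using bounded_linear.tendsto[OF bounded_linear_scaleC pt] by (simp add: clop_scaleC)
  qed
  then have "bounded_clinear (blinfun_apply L)"
    by (simp add: bounded_clinear_def blinfun.bounded_linear_right)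
  then have "clop_apply (Clop (blinfun_apply L)) = blinfun_apply L" by (rule Clop_apply)
  then have "Blinfun (clop_apply (Clop (blinfun_apply L))) = L"
    by (simp add: blinfun_apply_inverse)
  then have "X \<longlonglongrightarrow> Clop (blinfun_apply L)"
    using L nd by (simp add: LIMSEQ_iff) metis
  then show ?thesis by (auto simp: convergent_def)
qed

instance clop :: (complex_normed_vector, complex_banach) complex_banach
  by standard (rule clop_Cauchy_convergent)

lemma norm_clop_compose: "norm (S o\<^sub>C T) \<le> norm S * norm T"
proof (rule norm_clop_le)
  fix x
  have "norm (clop_apply S (clop_apply T x)) \<le> norm S * norm (clop_apply T x)"
    by (rule norm_clop_apply)
  also have "\<dots> \<le> norm S * (norm T * norm x)"
    by (intro mult_left_mono norm_clop_apply) simp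
  finally show "norm (clop_apply (S o\<^sub>C T) x) \<le> norm S * norm T * norm x"
    by (simp add: mult.assoc)
qed simp

lemma bounded_bilinear_clop_compose: "bounded_bilinear (o\<^sub>C)"
proof
  show "\<exists>K. \<forall>S T. norm (S o\<^sub>C T) \<le> norm S * norm T * K"
    by (rule exI[of _ 1]) (simp add: norm_clop_compose)
qed (rule clop_eqI; simp add: plus_clop.rep_eq clop_add scaleR_clop_def scaleC_clop.rep_eq clop_scaleC)+

lemma scaleR_clop_apply: "clop_apply (r *\<^sub>R T) x = r *\<^sub>R clop_apply T x"
  unfolding scaleR_clop_def scaleC_clop.rep_eq by (rule scaleC_of_real)

lemma clop_tendsto:
  assumes "X \<longlonglongrightarrow> T"
  shows "(\<lambda>n. clop_apply (X n) x) \<longlonglongrightarrow> clop_apply T x"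
proof (rule bounded_linear.tendsto[OF _ assms])
  show "bounded_linear (\<lambda>T. clop_apply T x)"
    by (rule bounded_linear_intro[of _ "norm x"])
      (simp_all add: plus_clop.rep_eq scaleR_clop_apply norm_clop_apply)
qed

lemma clop_eq_dense:
  assumes "closure (cspan D) = UNIV" and eq: "\<And>x. x \<in> D \<Longrightarrow> clop_apply S x = clop_apply T x"
  shows "S = T"
proof (rule clop_eqI)
  fix x
  have "complex_vector.subspace {x. clop_apply S x = clop_apply T x}"
    by (auto simp: complex_vector.subspace_def clop_add clop_scaleC)
  then have "cspan D \<subseteq> {x. clop_apply S x = clop_apply T x}"
    using eq by (intro complex_vector.span_minimal) auto
  moreover have "closed {x. clop_apply S x = clop_apply T x}"
    by (intro closed_Collect_eq bounded_linear.continuous_on[OF bounded_linear_clop] continuous_on_id)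
  ultimately have "closure (cspan D) \<subseteq> {x. clop_apply S x = clop_apply T x}"
    by (rule closure_minimal)
  then show "clop_apply S x = clop_apply T x" using assms(1) by blast
qed

lemma csubspace_closure:
  fixes S :: "'a::complex_normed_vector set"
  assumes "complex_vector.subspace S"
  shows "complex_vector.subspace (closure S)"
proof (rule complex_vector.subspaceI)
  show "0 \<in> closure S"
    using assms closure_subset complex_vector.subspace_0 by blast
  show "x + y \<in> closure S" if "x \<in> closure S" "y \<in> closure S" for x y
  proof -
    obtain X where "\<forall>n. X n \<in> S" "X \<longlonglongrightarrow> x"
      using \<open>x \<in> closure S\<close> unfolding closure_sequential by blast
    moreover obtain Y where "\<forall>n. Y n \<in> S" "Y \<longlonglongrightarrow> y"
      using \<open>y \<in> closure S\<close> unfolding closure_sequential by blast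
    ultimately have "\<And>n. X n + Y n \<in> S" "(\<lambda>n. X n + Y n) \<longlonglongrightarrow> x + y"
      using assms by (auto intro: complex_vector.subspace_add tendsto_add)
    then show ?thesis unfolding closure_sequential by (intro exI[of _ "\<lambda>n. X n + Y n"]) auto
  qed
  show "c *\<^sub>C x \<in> closure S" if "x \<in> closure S" for c x
  proof -
    obtain X where "\<forall>n. X n \<in> S" "X \<longlonglongrightarrow> x"
      using \<open>x \<in> closure S\<close> unfolding closure_sequential by blast
    then have "\<And>n. c *\<^sub>C X n \<in> S" "(\<lambda>n. c *\<^sub>C X n) \<longlonglongrightarrow> c *\<^sub>C x"
      using assms by (auto intro: complex_vector.subspace_scale bounded_linear.tendsto[OF bounded_linear_scaleC])
    then show ?thesis unfolding closure_sequential by (intro exI[of _ "\<lambda>n. c *\<^sub>C X n"]) auto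
  qed
qed

text \<open>
  By the bound, the closure of \<open>G\<close> is again the graph of an operator, and convergence of first components
  of elements of \<open>G\<close> forces convergence of the second ones, so that this operator is defined everywhere.
\<close>

lemma bounded_graph_extension:
  fixes G :: "('a::complex_banach \<times> 'b::complex_banach) set"
  assumes sub: "complex_vector.subspace G"
    and bd: "\<And>v w. (v, w) \<in> G \<Longrightarrow> norm w \<le> C * norm v"
    and dense: "closure (fst ` G) = UNIV"
  obtains F :: "'a \<Rightarrow>\<^sub>\<complex> 'b" where "\<And>v w. (v, w) \<in> G \<Longrightarrow> clop_apply F v = w"
proof -
  have subc: "complex_vector.subspace (closure G)" by (rule csubspace_closure[OF sub])
  have "closed {p :: 'a \<times> 'b. norm (snd p) \<le> C * norm (fst p)}"
    by (intro closed_Collect_le continuous_intros)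
  then have "closure G \<subseteq> {p. norm (snd p) \<le> C * norm (fst p)}"
    using bd by (intro closure_minimal) auto
  then have bdc: "norm w \<le> C * norm v" if "(v, w) \<in> closure G" for v w using that by auto
  have uniq: "w = w'" if "(v, w) \<in> closure G" "(v, w') \<in> closure G" for v w w'
    using bdc[of 0 "w - w'"] complex_vector.subspace_diff[OF subc that] by simp
  have ex: "\<exists>w. (v, w) \<in> closure G" for v
  proof -
    have "v \<in> closure (fst ` G)" using dense by simp
    then obtain X where X: "\<forall>n. X n \<in> fst ` G" "X \<longlonglongrightarrow> v" unfolding closure_sequential by blast
    then have "\<forall>n. \<exists>w. (X n, w) \<in> G" by force
    then obtain Y where Y: "\<And>n. (X n, Y n) \<in> G" by metis
    have le: "norm (Y i - Y j) \<le> \<bar>C\<bar> * norm (X i - X j)" for i j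
    proof -
      have "norm (Y i - Y j) \<le> C * norm (X i - X j)"
        using complex_vector.subspace_diff[OF sub Y[of i] Y[of j]] by (intro bd) simp
      also have "\<dots> \<le> \<bar>C\<bar> * norm (X i - X j)" by (intro mult_right_mono) auto
      finally show ?thesis .
    qed
    have "Cauchy Y"
    proof (rule CauchyI)
      fix e :: real assume "0 < e"
      then have "0 < e / (\<bar>C\<bar> + 1)" by simp
      then obtain M where M: "\<And>i j. i \<ge> M \<Longrightarrow> j \<ge> M \<Longrightarrow> norm (X i - X j) < e / (\<bar>C\<bar> + 1)"
        using CauchyD[OF LIMSEQ_imp_Cauchy[OF X(2)]] by metis
      have "norm (Y i - Y j) < e" if "i \<ge> M" "j \<ge> M" for i j
      proof -
        have "norm (Y i - Y j) \<le> (\<bar>C\<bar> + 1) * norm (X i - X j)"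
          using le[of i j] by (simp add: distrib_right add_increasing2)
        also have "\<dots> < (\<bar>C\<bar> + 1) * (e / (\<bar>C\<bar> + 1))"
          using M[OF that] by (intro mult_strict_left_mono) auto
        also have "\<dots> = e" by (simp add: field_simps)
        finally show ?thesis .
      qed
      then show "\<exists>M. \<forall>i\<ge>M. \<forall>j\<ge>M. norm (Y i - Y j) < e" by blast
    qed
    then obtain w where "Y \<longlonglongrightarrow> w" using Cauchy_convergent_iff convergent_def by blast
    then have "(\<lambda>n. (X n, Y n)) \<longlonglongrightarrow> (v, w)" using X(2) by (intro tendsto_Pair)
    then have "(v, w) \<in> closure G" 
      unfolding closure_sequential using Y by (intro exI[of _ "\<lambda>n. (X n, Y n)"]) auto
    then show ?thesis by blast
  qed
  then obtain f where f: "\<And>v. (v, f v) \<in> closure G" by metis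
  have "bounded_clinear f"
  proof (rule bounded_clinear_intro[of _ C])
    show "f (v + w) = f v + f w" for v w
      using uniq[OF f] complex_vector.subspace_add[OF subc f[of v] f[of w]] by simp
    show "f (c *\<^sub>C v) = c *\<^sub>C f v" for c v
      using uniq[OF f] complex_vector.subspace_scale[OF subc f[of v], of c] by (simp add: scaleC_Pair)
    show "norm (f v) \<le> norm v * C" for v
      using bdc[OF f] by (simp add: mult.commute)
  qed
  then have "clop_apply (Clop f) = f" by (rule Clop_apply)
  moreover have "f v = w" if "(v, w) \<in> G" for v w
    using uniq[OF f] that closure_subset by blast
  ultimately show thesis using that[of "Clop f"] by simp
qed

section \<open>Automatic continuity of representations\<close>

text \<open>
  If \<open>\<parallel>\<rho> a\<parallel>\<^sup>2 = r\<close> exceeded \<open>\<parallel>a* a\<parallel>\<close>, then the Neumann series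
  \<open>e = \<Sum>n. (a* a / r)\<^sup>n\<^sup>+\<^sup>1\<close> would converge in \<open>B\<close>, and \<open>1 + \<rho> e\<close> would be a left inverse of
  \<open>1 - \<rho> (a* a) / r\<close>. But \<open>\<rho> (a* a)\<close> is a positive operator of norm \<open>r\<close>, so that
  \<open>1 - \<rho> (a* a) / r\<close> is not bounded below. Unlike the resolvent, the series is available without a unit.
\<close>

lemma star_rep_norm_le:
  fixes \<rho> :: "'b::complex_banach \<Rightarrow> 'h::complex_hilbert \<Rightarrow>\<^sub>\<complex> 'h"
  assumes rep: "star_rep B mul st \<rho>"
    and B: "closed B" "complex_vector.subspace B"
      "\<And>a b. a \<in> B \<Longrightarrow> b \<in> B \<Longrightarrow> mul a b \<in> B" "\<And>a. a \<in> B \<Longrightarrow> st a \<in> B"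
    and bil: "bounded_bilinear mul" and sm: "\<And>a b. norm (mul a b) \<le> norm a * norm b"
    and a: "a \<in> B"
  shows "(norm (\<rho> a))\<^sup>2 \<le> norm (mul (st a) a)"
proof (rule ccontr)
  define r where "r = (norm (\<rho> a))\<^sup>2"
  define S where "S = \<rho> a"
  define c where "c = complex_of_real (inverse r) *\<^sub>C mul (st a) a"
  assume "\<not> (norm (\<rho> a))\<^sup>2 \<le> norm (mul (st a) a)"
  then have less: "norm (mul (st a) a) < r" by (simp add: r_def)
  then have r: "0 < r" using norm_ge_zero le_less_trans by blast
  have cB: "c \<in> B" unfolding c_def using a B by (intro complex_vector.subspace_scale) auto
  have nc: "norm c < 1" using less r by (simp add: c_def norm_scaleC norm_inverse norm_divide divide_simps)
  define p where "p n = ((\<lambda>b. mul b c) ^^ n) c" for n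
  have pB: "p n \<in> B" for n by (induction n) (use cB B in \<open>auto simp: p_def\<close>)
  have pn: "norm (p n) \<le> norm c ^ n * norm c" for n
  proof (induction n)
    case (Suc n)
    have "norm (p (Suc n)) \<le> norm (p n) * norm c" using sm[of "p n" c] by (simp add: p_def)
    also have "\<dots> \<le> norm c ^ n * norm c * norm c" using Suc by (intro mult_right_mono) auto
    finally show ?case by (simp add: mult_ac)
  qed (simp add: p_def)
  have sump: "summable p"
    by (rule summable_comparison_test'[of "\<lambda>n. norm c ^ n * norm c" 0])
      (use nc pn in \<open>auto intro!: summable_mult2 summable_geometric\<close>)
  define e where "e = suminf p"
  have "(\<lambda>n. \<Sum>i<n. p i) \<longlonglongrightarrow> e" using sump unfolding e_def by (rule summable_LIMSEQ)
  then have eB: "e \<in> B"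
    using B(1) by (rule closed_sequentially[rotated 2]) (intro complex_vector.subspace_sum B pB)
  have "mul e c = (\<Sum>n. mul (p n) c)"
    using bounded_linear.suminf[OF bounded_bilinear.bounded_linear_left[OF bil] sump, of c]
    by (simp add: e_def)
  also have "\<dots> = (\<Sum>n. p (Suc n))" by (simp add: p_def)
  also have "\<dots> = e - c" using suminf_split_head[OF sump] by (simp add: e_def p_def)
  finally have e: "e = mul e c + c" by simp
  have rhoc: "\<rho> c = complex_of_real (inverse r) *\<^sub>C (adj S o\<^sub>C S)"
    using rep a B by (simp add: star_rep_def c_def S_def)
  have "\<rho> (mul e c + c) = \<rho> e o\<^sub>C \<rho> c + \<rho> c"
    using rep cB eB B by (simp add: star_rep_def)
  then have E: "\<rho> e = \<rho> e o\<^sub>C \<rho> c + \<rho> c" using e by simp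
  define M where "M = norm (\<rho> e) + 1"
  have M: "M \<ge> 1" by (simp add: M_def)
  have below: "(norm (clop_apply S v))\<^sup>2 \<le> r * (1 - inverse (M\<^sup>2)) * (norm v)\<^sup>2" for v
  proof -
    define u where "u = v - clop_apply (\<rho> c) v"
    have "clop_apply (\<rho> e) v = clop_apply (\<rho> e) (clop_apply (\<rho> c) v) + clop_apply (\<rho> c) v"
      using E by (metis clop_compose_apply plus_clop.rep_eq)
    then have "v = u + clop_apply (\<rho> e) u" by (simp add: u_def clop_diff)
    then have "norm v \<le> norm u + norm (\<rho> e) * norm u"
      using norm_triangle_ineq[of u "clop_apply (\<rho> e) u"] norm_clop_apply[of "\<rho> e" u] by simp
    then have "norm v \<le> M * norm u" by (simp add: M_def algebra_simps)
    then have "(norm v)\<^sup>2 \<le> M\<^sup>2 * (norm u)\<^sup>2"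
      using power_mono[of "norm v" "M * norm u" 2] by (simp add: power_mult_distrib)
    then have 1: "inverse (M\<^sup>2) * (norm v)\<^sup>2 \<le> (norm u)\<^sup>2" using M by (simp add: field_simps)
    define s where "s = (norm (clop_apply S v))\<^sup>2"
    have "(norm (clop_apply (adj S) (clop_apply S v)))\<^sup>2 \<le> r * s"
    proof -
      have "norm (clop_apply (adj S) (clop_apply S v)) \<le> norm S * norm (clop_apply S v)"
        by (meson norm_clop_apply norm_adj_le mult_right_mono norm_ge_zero order_trans)
      then show ?thesis
        using power_mono[OF _ norm_ge_zero, of _ _ 2] by (fastforce simp: power_mult_distrib r_def s_def S_def)
    qed
    moreover have "(norm u)\<^sup>2 = (norm v)\<^sup>2
        + (inverse r)\<^sup>2 * (norm (clop_apply (adj S) (clop_apply S v)))\<^sup>2 - 2 * inverse r * s"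
      by (simp add: u_def rhoc norm_diff_power2 scaleC_clop.rep_eq norm_scaleC cinner_scaleC_right
          power_mult_distrib cinner_adj[symmetric] cinner_norm s_def norm_inverse power_inverse)
        (use r in \<open>simp add: field_simps power2_eq_square\<close>)
    ultimately have "(norm u)\<^sup>2 \<le> (norm v)\<^sup>2 + (inverse r)\<^sup>2 * (r * s) - 2 * inverse r * s"
      using mult_left_mono[of "(norm (clop_apply (adj S) (clop_apply S v)))\<^sup>2" "r * s" "(inverse r)\<^sup>2"] by simp
    also have "\<dots> = (norm v)\<^sup>2 - inverse r * s" using r by (simp add: power2_eq_square)
    finally have "inverse (M\<^sup>2) * (norm v)\<^sup>2 \<le> (norm v)\<^sup>2 - inverse r * s" using 1 by linarith
    then have "r * (inverse r * s) \<le> r * ((norm v)\<^sup>2 - inverse (M\<^sup>2) * (norm v)\<^sup>2)"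
      using r by (intro mult_left_mono) auto
    moreover have "r * (inverse r * s) = s" using r by simp
    ultimately have "s \<le> r * ((norm v)\<^sup>2 - inverse (M\<^sup>2) * (norm v)\<^sup>2)" by metis
    then show ?thesis by (simp add: s_def algebra_simps)
  qed
  have le1: "0 \<le> 1 - inverse (M\<^sup>2)" using M by (simp add: inverse_le_1_iff)
  have "norm S \<le> sqrt (r * (1 - inverse (M\<^sup>2)))"
  proof (rule norm_clop_le)
    show "norm (clop_apply S v) \<le> sqrt (r * (1 - inverse (M\<^sup>2))) * norm v" for v
      using real_sqrt_le_mono[OF below[of v]] by (simp add: real_sqrt_mult)
  qed (use r le1 in simp)
  then have "r \<le> (sqrt (r * (1 - inverse (M\<^sup>2))))\<^sup>2"
    unfolding r_def S_def by (rule power_mono) simp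
  also have "\<dots> = r * (1 - inverse (M\<^sup>2))" using r le1 by simp
  also have "\<dots> < r" using r M by (simp add: algebra_simps)
  finally show False by simp
qed

lemma star_rep_cstar_norm_le:
  fixes \<pi> :: "'a::cstar_algebra \<Rightarrow> 'h::complex_hilbert \<Rightarrow>\<^sub>\<complex> 'h"
  assumes "star_rep UNIV (*) star \<pi>"
  shows "norm (\<pi> a) \<le> norm a"
proof -
  have "(norm (\<pi> a))\<^sup>2 \<le> norm (star a * a)"
    by (rule star_rep_norm_le[OF assms])
      (auto simp: bounded_bilinear_mult norm_mult_ineq complex_vector.subspace_UNIV)
  then show ?thesis by (simp add: cstar_identity)
qed

section \<open>Operators determined on a total family of vectors\<close>

text \<open>
  Formal linear combinations, rather than elements of the span, can be evaluated on two families at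
  once; this gives the graph of the operator that takes the one family to the other.
\<close>

definition lincomb :: "('i \<Rightarrow> 'a::complex_vector) \<Rightarrow> (complex \<times> 'i) list \<Rightarrow> 'a" where
  "lincomb f ps = (\<Sum>(c, i)\<leftarrow>ps. c *\<^sub>C f i)"

lemma lincomb_simps [simp]:
  "lincomb f [] = 0" "lincomb f ((c, i) # ps) = c *\<^sub>C f i + lincomb f ps"
  "lincomb f (ps @ qs) = lincomb f ps + lincomb f qs"
  by (simp_all add: lincomb_def)

lemma lincomb_scale: "lincomb f (map (\<lambda>(d, i). (c * d, i)) ps) = c *\<^sub>C lincomb f ps"
  by (induction ps) (auto simp: scaleC_add_right scaleC_scaleC)

lemma cspan_range_lincomb: "cspan (range f) \<subseteq> range (lincomb f)"
proof (rule complex_vector.span_minimal)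
  have "f i = lincomb f [(1, i)]" for i by (simp add: scaleC_one)
  then show "range f \<subseteq> range (lincomb f)" by blast
  show "complex_vector.subspace (range (lincomb f))"
  proof (rule complex_vector.subspaceI)
    have "0 = lincomb f []" by simp
    then show "0 \<in> range (lincomb f)" by blast
    show "x + y \<in> range (lincomb f)" if "x \<in> range (lincomb f)" "y \<in> range (lincomb f)" for x y
    proof -
      obtain ps qs where "x = lincomb f ps" "y = lincomb f qs"
        using \<open>x \<in> range (lincomb f)\<close> \<open>y \<in> range (lincomb f)\<close> by blast
      then have "x + y = lincomb f (ps @ qs)" by simp
      then show ?thesis by blast
    qed
    show "c *\<^sub>C x \<in> range (lincomb f)" if "x \<in> range (lincomb f)" for c x
      using that lincomb_scale[of f c, symmetric] by blast
  qed
qed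

lemma cinner_lincomb_cong:
  assumes "\<And>i j. cinner (f i) (g j) = cinner (f' i) (g' j)"
  shows "cinner (lincomb f ps) (lincomb g qs) = cinner (lincomb f' ps) (lincomb g' qs)"
proof -
  have "cinner (f i) (lincomb g qs) = cinner (f' i) (lincomb g' qs)" for i
    by (induction qs) (auto simp: cinner_linear assms)
  then show ?thesis by (induction ps) (auto simp: cinner_linear)
qed

lemma extend_from_total_family:
  fixes f :: "'i \<Rightarrow> 'a::complex_banach" and g :: "'i \<Rightarrow> 'b::complex_banach"
  assumes total: "closure (cspan (range f)) = UNIV"
    and bd: "\<And>ps. norm (lincomb g ps) \<le> C * norm (lincomb f ps)"
  obtains F where "\<And>i. clop_apply F (f i) = g i"
proof -
  define G where "G = range (\<lambda>ps. (lincomb f ps, lincomb g ps))"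
  have sub: "complex_vector.subspace G"
  proof (rule complex_vector.subspaceI)
    have "0 = (lincomb f [], lincomb g [])" by (simp add: zero_prod_def)
    then show "0 \<in> G" unfolding G_def by blast
    show "p + q \<in> G" if "p \<in> G" "q \<in> G" for p q
    proof -
      obtain ps qs where "p = (lincomb f ps, lincomb g ps)" "q = (lincomb f qs, lincomb g qs)"
        using \<open>p \<in> G\<close> \<open>q \<in> G\<close> unfolding G_def by blast
      then have "p + q = (lincomb f (ps @ qs), lincomb g (ps @ qs))" by simp
      then show ?thesis unfolding G_def by blast
    qed
    show "c *\<^sub>C p \<in> G" if p: "p \<in> G" for c p
    proof -
      obtain ps where "p = (lincomb f ps, lincomb g ps)" using p unfolding G_def by blast
      then have "c *\<^sub>C p = (lincomb f (map (\<lambda>(d, i). (c * d, i)) ps), lincomb g (map (\<lambda>(d, i). (c * d, i)) ps))"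
        by (simp add: scaleC_Pair lincomb_scale)
      then show ?thesis unfolding G_def by blast
    qed
  qed
  have "fst ` G = range (lincomb f)" by (auto simp: G_def image_image)
  then have "closure (fst ` G) = UNIV"
    using total closure_mono[OF cspan_range_lincomb[of f]] by auto
  moreover have "norm w \<le> C * norm v" if "(v, w) \<in> G" for v w
    using that bd by (auto simp: G_def)
  ultimately obtain F where F: "\<And>v w. (v, w) \<in> G \<Longrightarrow> clop_apply F v = w"
    using bounded_graph_extension[OF sub] by metis
  have "clop_apply F (f i) = g i" for i
  proof (rule F)
    have "(f i, g i) = (lincomb f [(1, i)], lincomb g [(1, i)])" by (simp add: scaleC_one)
    then show "(f i, g i) \<in> G" unfolding G_def by blast
  qed
  then show thesis by (rule that)
qed

text \<open>
  Equal Gram kernels make \<open>f i \<mapsto> g i\<close> isometric on linear combinations; the adjoint of its extension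
  takes \<open>g i\<close> back to \<open>f i\<close>, because it has the right inner products with the total family \<open>f\<close>.
\<close>

lemma unitary_of_total_families:
  fixes f :: "'i \<Rightarrow> 'h::complex_hilbert" and g :: "'i \<Rightarrow> 'k::complex_hilbert"
  assumes totf: "closure (cspan (range f)) = UNIV" and totg: "closure (cspan (range g)) = UNIV"
    and gram: "\<And>i j. cinner (f i) (f j) = cinner (g i) (g j)"
  obtains U where "\<And>i. clop_apply U (f i) = g i" "adj U o\<^sub>C U = clop_id" "U o\<^sub>C adj U = clop_id"
proof -
  have "norm (lincomb g ps) \<le> 1 * norm (lincomb f ps)" for ps
  proof -
    have "(norm (lincomb g ps))\<^sup>2 = (norm (lincomb f ps))\<^sup>2"
      unfolding norm_power2_cinner cinner_lincomb_cong[OF gram, where ps = ps and qs = ps] ..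
    then show ?thesis by simp
  qed
  then obtain U where U: "\<And>i. clop_apply U (f i) = g i"
    using extend_from_total_family[OF totf] by metis
  have Ug: "clop_apply (adj U) (g i) = f i" for i
    by (rule cinner_ext_dense[OF totf]) (auto simp: cinner_adj[symmetric] U gram)
  have "adj U o\<^sub>C U = clop_id" by (rule clop_eq_dense[OF totf]) (auto simp: U Ug)
  moreover have "U o\<^sub>C adj U = clop_id" by (rule clop_eq_dense[OF totg]) (auto simp: U Ug)
  ultimately show thesis using U that by blast
qed

lemma root_test_power2:
  fixes a b K :: real
  assumes "0 \<le> a" "0 \<le> b" and le: "\<And>k. a ^ (2 ^ k) \<le> K * b ^ (2 ^ k)"
  shows "a \<le> b"
proof (rule ccontr)
  assume "\<not> a \<le> b"
  then have ab: "b < a" by simp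
  show False
  proof (cases "b = 0")
    case True
    then have "a \<le> 0" using le[of 0] by simp
    with ab True show False by simp
  next
    case False
    then have b: "0 < b" using assms by simp
    then have "1 < a / b" using ab by simp
    then obtain n where n: "K < (a / b) ^ n" using real_arch_pow by blast
    have "(a / b) ^ n \<le> (a / b) ^ (2 ^ n)"
      using \<open>1 < a / b\<close> by (intro power_increasing less_imp_le[OF less_exp]) auto
    also have "\<dots> \<le> K" using le[of n] b by (simp add: power_divide field_simps)
    finally show False using n by simp
  qed
qed

text \<open>
  The family \<open>f n\<close> behaves as if \<open>f n = S\<^sup>n f 0\<close> for a self-adjoint operator \<open>S\<close>, which is not known to
  exist yet. Cauchy-Schwarz makes the norms \<open>g n\<close> of a linear combination satisfy
  \<open>g(n)\<^sup>2 \<le> g(0) g(2n)\<close>, so that \<open>g(1)\<close> is controlled by the growth rate of \<open>g\<close> along the powers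
  of two; in this way bounds on the single vectors give the same bound on linear combinations.
\<close>

lemma lincomb_moment_bound:
  fixes f :: "nat \<Rightarrow> 'i \<Rightarrow> 'h::complex_hilbert"
  assumes mom: "\<And>n i j. cinner (f n i) (f n j) = cinner (f 0 i) (f (2 * n) j)"
    and growth: "\<And>n i. norm (f n i) \<le> K i * s ^ n" and s: "0 \<le> s"
  shows "norm (lincomb (f 1) ps) \<le> s * norm (lincomb (f 0) ps)"
proof -
  define g where "g n = norm (lincomb (f n) ps)" for n
  have g0: "0 \<le> g n" for n by (simp add: g_def)
  have sq: "(g n)\<^sup>2 \<le> g 0 * g (2 * n)" for n
  proof -
    have "(g n)\<^sup>2 = Re (cinner (lincomb (f 0) ps) (lincomb (f (2 * n)) ps))"
      using cinner_lincomb_cong[OF mom[of n], where ps = ps and qs = ps] by (simp add: g_def norm_power2_cinner)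
    also have "\<dots> \<le> g 0 * g (2 * n)"
      unfolding g_def by (meson complex_Re_le_cmod cinner_Cauchy_Schwarz order_trans)
    finally show ?thesis .
  qed
  define C where "C = (\<Sum>(c, i)\<leftarrow>ps. cmod c * K i)"
  have gr: "g n \<le> C * s ^ n" for n
    unfolding g_def C_def
  proof (induction ps)
    case (Cons p ps)
    obtain c i where p: "p = (c, i)" by (cases p)
    have "norm (c *\<^sub>C f n i) \<le> cmod c * (K i * s ^ n)"
      unfolding norm_scaleC by (intro mult_left_mono growth) simp
    with Cons show ?case
      using norm_triangle_ineq[of "c *\<^sub>C f n i" "lincomb (f n) ps"] by (simp add: p algebra_simps)
  qed simp
  show ?thesis
  proof (cases "g 0 = 0")
    case True
    then show ?thesis using sq[of 1] by (simp add: g_def)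
  next
    case False
    then have pos: "0 < g 0" using g0[of 0] by simp
    have "(g 1 / g 0) ^ (2 ^ k) \<le> g (2 ^ k) / g 0" for k
    proof (induction k)
      case (Suc k)
      have "(g 1 / g 0) ^ (2 ^ Suc k) = ((g 1 / g 0) ^ (2 ^ k))\<^sup>2"
        by (simp add: power_mult[symmetric] mult.commute)
      also have "\<dots> \<le> (g (2 ^ k) / g 0)\<^sup>2"
        using Suc g0 by (intro power_mono) auto
      also have "\<dots> \<le> g (2 ^ Suc k) / g 0"
        using sq[of "2 ^ k"] pos by (simp add: power_divide power2_eq_square field_simps)
      finally show ?case .
    qed simp
    moreover have "g (2 ^ k) / g 0 \<le> C / g 0 * s ^ (2 ^ k)" for k
      using gr[of "2 ^ k"] pos by (simp add: field_simps)
    ultimately have "(g 1 / g 0) ^ (2 ^ k) \<le> C / g 0 * s ^ (2 ^ k)" for k by (rule order_trans)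
    then have "g 1 / g 0 \<le> s"
      by (intro root_test_power2[OF _ s] divide_nonneg_nonneg g0)
    then show ?thesis using pos by (simp add: g_def field_simps)
  qed
qed

section \<open>Compact operators and the linking algebra of a Hilbert module\<close>

context hilbert_module
begin

text \<open>
  Operators on a Hilbert module need not have an adjoint. As a relation, adjointness can be carried
  through algebraic operations and limits before existence is known.
\<close>

definition adjoint_pair :: "'x \<Rightarrow>\<^sub>\<complex> 'x \<Rightarrow> 'x \<Rightarrow>\<^sub>\<complex> 'x \<Rightarrow> bool" where
  "adjoint_pair T S \<longleftrightarrow> (\<forall>x y. ip (clop_apply T x) y = ip x (clop_apply S y))"

abbreviation compacts :: "('x \<Rightarrow>\<^sub>\<complex> 'x) set" where
  "compacts \<equiv> compact_ops act ip"

abbreviation madj :: "'x \<Rightarrow>\<^sub>\<complex> 'x \<Rightarrow> 'x \<Rightarrow>\<^sub>\<complex> 'x" where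
  "madj \<equiv> adj_wrt ip ip"

lemma ip_zero_left [simp]: "ip 0 z = 0"
  using ip_scaleC_left[of 0 0 z] by simp

lemma ip_zero_right [simp]: "ip y 0 = 0"
  using ip_scaleC_right[of y 0 0] by simp

lemma ip_diff_right: "ip x (y - z) = ip x y - ip x z"
  using ip_add_right[of x "y - z" z] by simp

lemma ip_act_left: "ip (act x a) y = star a * ip x y"
  by (metis ip_act_right ip_commute star_mult)

lemma ip_self_eq_0_iff: "ip x x = 0 \<longleftrightarrow> x = 0"
  using norm_ip_self[of x] by auto

lemma ip_ext:
  assumes "\<And>x. ip x y = ip x z"
  shows "y = z"
proof -
  have "ip (y - z) (y - z) = 0" using assms[of "y - z"] by (simp add: ip_diff_right)
  then show ?thesis by (simp add: ip_self_eq_0_iff)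
qed

lemma bounded_linear_ip_right: "bounded_linear (ip x)"
  by (rule bounded_linear_intro[of _ "4 * norm x"])
    (simp_all add: ip_add_right ip_scaleC_right scaleC_of_real[symmetric] norm_ip_le)

lemma bounded_linear_ip_left: "bounded_linear (\<lambda>x. ip x y)"
proof (rule bounded_linear_intro[of _ "4 * norm y"])
  show "norm (ip x y) \<le> norm x * (4 * norm y)" for x
    using norm_ip_le[of x y] by (simp add: mult_ac)
qed (simp_all add: ip_add_left ip_scaleC_left scaleC_of_real[symmetric])

lemma adjoint_pair_sym: "adjoint_pair T S \<Longrightarrow> adjoint_pair S T"
  unfolding adjoint_pair_def by (metis ip_commute)

text \<open>
  The factor 4 comes from the Cauchy-Schwarz inequality \<open>norm_ip_le\<close>. A bound by some multiple of
  \<open>norm T\<close> is what makes the adjoints of a convergent sequence converge.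
\<close>

lemma adjoint_pair_norm_le:
  assumes "adjoint_pair T S"
  shows "norm S \<le> 4 * norm T"
proof (rule norm_clop_le)
  fix y
  show "norm (clop_apply S y) \<le> 4 * norm T * norm y"
  proof (cases "clop_apply S y = 0")
    case False
    have "(norm (clop_apply S y))\<^sup>2 = norm (ip (clop_apply T (clop_apply S y)) y)"
      using assms by (simp add: adjoint_pair_def norm_ip_self)
    also have "\<dots> \<le> norm y * (4 * norm (clop_apply T (clop_apply S y)))" by (rule norm_ip_le)
    also have "\<dots> \<le> norm y * (4 * (norm T * norm (clop_apply S y)))"
      by (intro mult_left_mono norm_clop_apply) auto
    finally show ?thesis using False by (simp add: power2_eq_square mult_ac)
  qed simp
qed simp

lemma adjoint_pair_act:
  assumes "adjoint_pair T S"
  shows "clop_apply T (act x a) = act (clop_apply T x) a"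
  by (rule ip_ext) (metis adjoint_pair_sym[OF assms] adjoint_pair_def ip_act_right)

lemma adjoint_pair_add:
  "adjoint_pair T S \<Longrightarrow> adjoint_pair T' S' \<Longrightarrow> adjoint_pair (T + T') (S + S')"
  by (simp add: adjoint_pair_def plus_clop.rep_eq ip_add_left ip_add_right)

lemma adjoint_pair_diff:
  assumes "adjoint_pair T S" "adjoint_pair T' S'"
  shows "adjoint_pair (T - T') (S - S')"
proof -
  have "ip (x - x') y = ip x y - ip x' y" for x x' y
    using ip_add_left[of "x - x'" x' y] by simp
  then show ?thesis using assms by (simp add: adjoint_pair_def minus_clop.rep_eq ip_diff_right)
qed

lemma adjoint_pair_scaleC: "adjoint_pair T S \<Longrightarrow> adjoint_pair (c *\<^sub>C T) (cnj c *\<^sub>C S)"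
  by (simp add: adjoint_pair_def scaleC_clop.rep_eq ip_scaleC_left ip_scaleC_right)

lemma adjoint_pair_compose:
  "adjoint_pair T S \<Longrightarrow> adjoint_pair T' S' \<Longrightarrow> adjoint_pair (T o\<^sub>C T') (S' o\<^sub>C S)"
  by (simp add: adjoint_pair_def)

lemma adjoint_pair_theta: "adjoint_pair (theta act ip x y) (theta act ip y x)"
  unfolding adjoint_pair_def
  by (metis ip_act_left ip_act_right ip_commute theta_apply)

lemma madj_eq: "adjoint_pair T S \<Longrightarrow> madj T = S"
  by (rule adj_wrt_unique) (auto simp: adjoint_pair_def intro: ip_ext)

lemma closed_compacts: "closed compacts"
  by (simp add: compact_ops_def)

lemma csubspace_compacts: "complex_vector.subspace compacts"
  unfolding compact_ops_def
  by (rule csubspace_closure) (rule complex_vector.subspace_span)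

lemma theta_compact: "theta act ip x y \<in> compacts"
  unfolding compact_ops_def
  by (rule subsetD[OF closure_subset], rule complex_vector.span_base) blast

lemma compacts_subset:
  assumes "complex_vector.subspace Q" "closed Q" "\<And>x y. theta act ip x y \<in> Q"
  shows "compacts \<subseteq> Q"
  unfolding compact_ops_def
  using assms by (intro closure_minimal complex_vector.span_minimal) auto

text \<open>
  Along a convergent sequence of operators the adjoints form a Cauchy sequence, and the limit of the
  adjoints is an adjoint of the limit.
\<close>

lemma closed_adjointable: "closed {T. \<exists>S\<in>compacts. adjoint_pair T S}"
  unfolding closed_sequential_limits
proof (intro allI impI, elim conjE)
  fix X T
  assume "\<forall>n. X n \<in> {T. \<exists>S\<in>compacts. adjoint_pair T S}" and X: "X \<longlonglongrightarrow> T"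
  then have "\<forall>n. \<exists>S. S \<in> compacts \<and> adjoint_pair (X n) S" by blast
  then obtain Y where Y: "\<And>n. Y n \<in> compacts" "\<And>n. adjoint_pair (X n) (Y n)" by metis
  have "Cauchy Y"
  proof (rule CauchyI)
    fix e :: real assume "0 < e"
    then have "0 < e / 4" by simp
    then obtain M where M: "\<And>i j. i \<ge> M \<Longrightarrow> j \<ge> M \<Longrightarrow> norm (X i - X j) < e / 4"
      using CauchyD[OF LIMSEQ_imp_Cauchy[OF X]] by metis
    have "norm (Y i - Y j) < e" if "i \<ge> M" "j \<ge> M" for i j
      using adjoint_pair_norm_le[OF adjoint_pair_diff[OF Y(2)[of i] Y(2)[of j]]] M[OF that] by simp
    then show "\<exists>M. \<forall>i\<ge>M. \<forall>j\<ge>M. norm (Y i - Y j) < e" by blast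
  qed
  then obtain S where S: "Y \<longlonglongrightarrow> S" using Cauchy_convergent_iff convergent_def by blast
  have "ip (clop_apply T x) y = ip x (clop_apply S y)" for x y
  proof (rule LIMSEQ_unique)
    show "(\<lambda>n. ip (clop_apply (X n) x) y) \<longlonglongrightarrow> ip (clop_apply T x) y"
      by (rule bounded_linear.tendsto[OF bounded_linear_ip_left clop_tendsto[OF X]])
    show "(\<lambda>n. ip (clop_apply (X n) x) y) \<longlonglongrightarrow> ip x (clop_apply S y)"
      using bounded_linear.tendsto[OF bounded_linear_ip_right clop_tendsto[OF S], of x y] Y(2)
      by (simp add: adjoint_pair_def)
  qed
  moreover have "S \<in> compacts" by (rule closed_sequentially[OF closed_compacts Y(1) S])
  ultimately show "T \<in> {T. \<exists>S\<in>compacts. adjoint_pair T S}" by (auto simp: adjoint_pair_def)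
qed

lemma compact_adjoint:
  assumes "T \<in> compacts"
  shows "adjoint_pair T (madj T)" and "madj T \<in> compacts"
proof -
  have "compacts \<subseteq> {T. \<exists>S\<in>compacts. adjoint_pair T S}"
  proof (rule compacts_subset[OF _ closed_adjointable])
    show "complex_vector.subspace {T. \<exists>S\<in>compacts. adjoint_pair T S}"
    proof (rule complex_vector.subspaceI)
      have "adjoint_pair 0 0" by (simp add: adjoint_pair_def zero_clop.rep_eq)
      then show "0 \<in> {T. \<exists>S\<in>compacts. adjoint_pair T S}"
        using complex_vector.subspace_0[OF csubspace_compacts] by blast
      show "T + T' \<in> {T. \<exists>S\<in>compacts. adjoint_pair T S}"
        if "T \<in> {T. \<exists>S\<in>compacts. adjoint_pair T S}" "T' \<in> {T. \<exists>S\<in>compacts. adjoint_pair T S}" for T T'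
        using that adjoint_pair_add complex_vector.subspace_add[OF csubspace_compacts] by blast
      show "c *\<^sub>C T \<in> {T. \<exists>S\<in>compacts. adjoint_pair T S}"
        if "T \<in> {T. \<exists>S\<in>compacts. adjoint_pair T S}" for c T
        using that adjoint_pair_scaleC complex_vector.subspace_scale[OF csubspace_compacts] by blast
    qed
    show "theta act ip x y \<in> {T. \<exists>S\<in>compacts. adjoint_pair T S}" for x y
      using adjoint_pair_theta theta_compact by blast
  qed
  then obtain S where "S \<in> compacts" "adjoint_pair T S" using assms by blast
  then show "adjoint_pair T (madj T)" "madj T \<in> compacts" by (simp_all add: madj_eq)
qed

lemma ip_madj: "T \<in> compacts \<Longrightarrow> ip (clop_apply T x) y = ip x (clop_apply (madj T) y)"
  using compact_adjoint(1) by (simp add: adjoint_pair_def)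

lemma compact_act: "T \<in> compacts \<Longrightarrow> clop_apply T (act x a) = act (clop_apply T x) a"
  by (rule adjoint_pair_act[OF compact_adjoint(1)])

lemma compact_compose:
  assumes "R \<in> compacts" "T \<in> compacts"
  shows "R o\<^sub>C T \<in> compacts"
proof -
  have bl: "bounded_linear (\<lambda>T. R o\<^sub>C T)"
    by (rule bounded_bilinear.bounded_linear_right[OF bounded_bilinear_clop_compose])
  have "compacts \<subseteq> (\<lambda>T. R o\<^sub>C T) -` compacts"
  proof (rule compacts_subset)
    have "R o\<^sub>C (T + T') = R o\<^sub>C T + R o\<^sub>C T'" "R o\<^sub>C (c *\<^sub>C T) = c *\<^sub>C (R o\<^sub>C T)" "R o\<^sub>C 0 = (0 :: 'x \<Rightarrow>\<^sub>\<complex> 'x)" for T T' :: "'x \<Rightarrow>\<^sub>\<complex> 'x" and c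
      by (auto intro!: clop_eqI simp: plus_clop.rep_eq scaleC_clop.rep_eq zero_clop.rep_eq clop_add clop_scaleC)
    then show "complex_vector.subspace ((\<lambda>T. R o\<^sub>C T) -` compacts)"
      using csubspace_compacts by (simp add: complex_vector.subspace_def)
    show "closed ((\<lambda>T. R o\<^sub>C T) -` compacts)"
      by (rule closed_vimage[OF closed_compacts bounded_linear.continuous_on[OF bl continuous_on_id]])
    show "theta act ip x y \<in> (\<lambda>T. R o\<^sub>C T) -` compacts" for x y
    proof -
      have "R o\<^sub>C theta act ip x y = theta act ip (clop_apply R x) y"
        by (rule clop_eqI) (simp add: compact_act[OF assms(1)])
      then show ?thesis by (simp add: theta_compact)
    qed
  qed
  then show ?thesis using assms(2) by blast
qed

text \<open>
  Closure under products uses adjoints of compact operators: \<open>z \<mapsto> \<langle>y, T z\<rangle>\<close>, which occurs in the lower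
  left entry, is given by the vector \<open>T* y\<close>.
\<close>

lemma linking_algebra_compose:
  assumes "P \<in> linking_algebra act ip" "Q \<in> linking_algebra act ip"
  shows "P o\<^sub>C Q \<in> linking_algebra act ip"
proof -
  obtain T x y a T' x' y' a' where TT: "T \<in> compacts" "T' \<in> compacts"
    and P: "P = linking_op act ip T x y a" and Q: "Q = linking_op act ip T' x' y' a'"
    using assms by (auto simp: linking_algebra_def)
  have "P o\<^sub>C Q = linking_op act ip (T o\<^sub>C T' + theta act ip x y') (clop_apply T x' + act x a')
      (clop_apply (madj T') y + act y' (star a)) (ip y x' + a * a')"
  proof (rule clop_eqI)
    fix v :: "'x \<times> 'a"
    obtain z b where v: "v = (z, b)" by (cases v)
    have 1: "ip (clop_apply (madj T') y) z = ip y (clop_apply T' z)"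
      using ip_madj[OF TT(2), of z y] by (metis ip_commute)
    have 2: "ip (act y' (star a)) z = a * ip y' z" by (simp add: ip_act_left star_star)
    show "clop_apply (P o\<^sub>C Q) v = clop_apply (linking_op act ip (T o\<^sub>C T' + theta act ip x y')
        (clop_apply T x' + act x a') (clop_apply (madj T') y + act y' (star a)) (ip y x' + a * a')) v"
      by (simp add: v P Q linking_op_apply plus_clop.rep_eq clop_add compact_act[OF TT(1)] act_add_left
          act_add_right act_act ip_add_left ip_add_right ip_act_right 1 2 distrib_left distrib_right mult.assoc)
  qed
  moreover have "T o\<^sub>C T' + theta act ip x y' \<in> compacts"
    by (intro complex_vector.subspace_add[OF csubspace_compacts] compact_compose TT theta_compact)
  ultimately show ?thesis unfolding linking_algebra_def by blast
qed

lemma linking_algebra_star: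
  assumes "P \<in> linking_algebra act ip"
  shows "linking_star ip P \<in> linking_algebra act ip"
proof -
  obtain T x y a where T: "T \<in> compacts" and P: "P = linking_op act ip T x y a"
    using assms by (auto simp: linking_algebra_def)
  have "linking_star ip P = linking_op act ip (madj T) y x (star a)"
    unfolding linking_star_def
  proof (rule adj_wrt_unique)
    fix u v :: "'x \<times> 'a"
    have "star (ip y (fst u)) = ip (fst u) y" by (metis ip_commute)
    then show "ip_sum ip (clop_apply P u) v = ip_sum ip u (clop_apply (linking_op act ip (madj T) y x (star a)) v)"
      by (cases u; cases v)
        (simp add: ip_sum_def P linking_op_apply ip_add_left ip_add_right ip_act_left ip_act_right
          ip_madj[OF T] star_add star_mult distrib_left distrib_right mult.assoc)
  next
    fix v w :: "'x \<times> 'a" assume eq: "\<And>u. ip_sum ip u v = ip_sum ip u w"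
    have s0: "star (0 :: 'a) = 0" using star_scaleC[of 0 "0 :: 'a"] by simp
    have "fst v = fst w"
      using eq[of "(_, 0)"] by (intro ip_ext) (simp add: ip_sum_def s0)
    moreover have "star c * snd v = star c * snd w" for c
      using eq[of "(0, c)"] by (simp add: ip_sum_def)
    then have "star (snd v - snd w) * (snd v - snd w) = 0" by (simp add: right_diff_distrib)
    then have "snd v = snd w" using cstar_identity[of "snd v - snd w"] by simp
    ultimately show "v = w" by (rule prod_eqI)
  qed
  then show ?thesis using compact_adjoint(2)[OF T] unfolding linking_algebra_def by blast
qed

end

section \<open>The representation of the compact operators\<close>

text \<open>The part of a minimal Stinespring representation that does not involve the coisometry.\<close>

locale module_representation = hilbert_module act ip
  for act :: "'x::complex_banach \<Rightarrow> 'a::cstar_algebra \<Rightarrow> 'x" and ip :: "'x \<Rightarrow> 'x \<Rightarrow> 'a" +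
  fixes \<pi> :: "'a \<Rightarrow> 'h1::complex_hilbert \<Rightarrow>\<^sub>\<complex> 'h1"
    and \<Xi> :: "'x \<Rightarrow> 'h1 \<Rightarrow>\<^sub>\<complex> 'k1::complex_hilbert"
    and V :: "'h::complex_hilbert \<Rightarrow>\<^sub>\<complex> 'h1"
  assumes rep: "star_rep UNIV (*) star \<pi>"
    and pi_map: "phi_map ip \<pi> \<Xi>"
    and dense: "closure (cspan {clop_apply (\<Xi> x) (clop_apply V h) | x h. True}) = UNIV"
begin

definition gen :: "'x \<times> 'h \<Rightarrow> 'k1" where
  "gen p = clop_apply (\<Xi> (fst p)) (clop_apply V (snd p))"

lemma total_gen: "closure (cspan (range gen)) = UNIV"
proof -
  have "range gen = {clop_apply (\<Xi> x) (clop_apply V h) | x h. True}"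
    by (auto simp: gen_def image_iff) blast
  then show ?thesis using dense by simp
qed

lemma cinner_Xi: "cinner (clop_apply (\<Xi> x) k) (clop_apply (\<Xi> y) l) = cinner k (clop_apply (\<pi> (ip x y)) l)"
  using pi_map by (simp add: phi_map_def cinner_adj clop_compose_apply[symmetric] del: clop_compose_apply)

lemma pi_add: "\<pi> (a + b) = \<pi> a + \<pi> b"
  and pi_scaleC: "\<pi> (c *\<^sub>C a) = c *\<^sub>C \<pi> a"
  and pi_mult: "\<pi> (a * b) = \<pi> a o\<^sub>C \<pi> b"
  using rep by (simp_all add: star_rep_def)

text \<open>
  The algebraic behaviour of \<open>\<Xi>\<close> is inherited from that of the second argument of the inner product
  of \<open>X\<close>, because inner products with a total family determine a vector.
\<close>

lemma Xi_add: "\<Xi> (x + y) = \<Xi> x + \<Xi> y"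
  by (intro clop_eqI cinner_ext_dense[OF total_gen])
    (auto simp: gen_def plus_clop.rep_eq cinner_linear cinner_Xi ip_add_right pi_add)

lemma Xi_scaleC: "\<Xi> (c *\<^sub>C x) = c *\<^sub>C \<Xi> x"
  by (intro clop_eqI cinner_ext_dense[OF total_gen])
    (auto simp: gen_def scaleC_clop.rep_eq cinner_linear cinner_Xi ip_scaleC_right pi_scaleC)

lemma Xi_act: "\<Xi> (act x a) = \<Xi> x o\<^sub>C \<pi> a"
  by (intro clop_eqI cinner_ext_dense[OF total_gen])
    (auto simp: gen_def cinner_Xi ip_act_right pi_mult)

lemma norm_Xi_le: "norm (clop_apply (\<Xi> x) k) \<le> norm x * norm k"
proof -
  have "(norm (clop_apply (\<Xi> x) k))\<^sup>2 = Re (cinner k (clop_apply (\<pi> (ip x x)) k))"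
    by (simp add: norm_power2_cinner cinner_Xi)
  also have "\<dots> \<le> norm k * norm (clop_apply (\<pi> (ip x x)) k)"
    by (meson complex_Re_le_cmod cinner_Cauchy_Schwarz order_trans)
  also have "\<dots> \<le> norm k * (norm (ip x x) * norm k)"
    by (meson mult_left_mono mult_right_mono norm_clop_apply norm_ge_zero order_trans
        star_rep_cstar_norm_le[OF rep])
  also have "\<dots> = (norm x * norm k)\<^sup>2"
    by (simp add: norm_ip_self power2_eq_square)
  finally show ?thesis by (rule power2_le_imp_le) simp
qed

text \<open>
  The operator \<open>\<sigma>(T)\<close>. It exists at least for compact \<open>T\<close>, and is then unique since the
  vectors \<open>\<Xi> x (V h)\<close> are total.
\<close>

definition induced :: "'x \<Rightarrow>\<^sub>\<complex> 'x \<Rightarrow> 'k1 \<Rightarrow>\<^sub>\<complex> 'k1" where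
  "induced T = (SOME S. \<forall>x h. clop_apply S (gen (x, h)) = gen (clop_apply T x, h))"

text \<open>
  With \<open>S = T* T\<close>, the vectors \<open>\<Xi> (S\<^sup>n x) (V h)\<close> satisfy the hypotheses of the moment bound, so that
  \<open>\<parallel>S\<parallel>\<close>, which bounds the growth of each of them, also bounds \<open>\<Xi> x (V h) \<mapsto> \<Xi> (S x) (V h)\<close>.
\<close>

lemma induced_apply:
  assumes T: "T \<in> compacts"
  shows "clop_apply (induced T) (gen (x, h)) = gen (clop_apply T x, h)"
proof -
  define S where "S = madj T o\<^sub>C T"
  define f where "f n p = gen ((clop_apply S ^^ n) (fst p), snd p)" for n p
  define g where "g p = gen (clop_apply T (fst p), snd p)" for p
  have S: "adjoint_pair S S"
    unfolding S_def
    by (rule adjoint_pair_compose[OF adjoint_pair_sym[OF compact_adjoint(1)[OF T]] compact_adjoint(1)[OF T]])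
  have Sn: "ip ((clop_apply S ^^ n) x) y = ip x ((clop_apply S ^^ n) y)" for n x y
  proof (induction n arbitrary: y)
    case (Suc n)
    have "ip ((clop_apply S ^^ Suc n) x) y = ip ((clop_apply S ^^ n) x) (clop_apply S y)"
      using S by (simp add: adjoint_pair_def)
    also have "\<dots> = ip x ((clop_apply S ^^ Suc n) y)" by (simp only: Suc funpow_Suc_right o_apply)
    finally show ?case .
  qed simp
  have bound: "norm (lincomb (f 1) ps) \<le> norm S * norm (lincomb (f 0) ps)" for ps
  proof (rule lincomb_moment_bound)
    show "cinner (f n p) (f n q) = cinner (f 0 p) (f (2 * n) q)" for n p q
      by (simp add: f_def gen_def cinner_Xi Sn mult_2 funpow_add)
    show "norm (f n p) \<le> norm (fst p) * norm (clop_apply V (snd p)) * norm S ^ n" for n p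
    proof -
      have "norm ((clop_apply S ^^ n) x) \<le> norm S ^ n * norm x" for x
      proof (induction n)
        case (Suc n)
        have "norm ((clop_apply S ^^ Suc n) x) \<le> norm S * norm ((clop_apply S ^^ n) x)"
          using norm_clop_apply by simp
        also have "\<dots> \<le> norm S * (norm S ^ n * norm x)" using Suc by (intro mult_left_mono) auto
        finally show ?case by (simp add: mult.assoc)
      qed simp
      then have "norm ((clop_apply S ^^ n) (fst p)) * norm (clop_apply V (snd p))
          \<le> norm S ^ n * norm (fst p) * norm (clop_apply V (snd p))"
        by (intro mult_right_mono) auto
      then show ?thesis
        using norm_Xi_le[of "(clop_apply S ^^ n) (fst p)" "clop_apply V (snd p)"]
        by (simp add: f_def gen_def mult_ac)
    qed
  qed simp
  have f0: "f 0 = gen" by (simp add: f_def fun_eq_iff)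
  have "norm (lincomb g ps) \<le> sqrt (norm S) * norm (lincomb gen ps)" for ps
  proof -
    have "cinner (g p) (g q) = cinner (f 0 p) (f 1 q)" for p q
      using compact_adjoint(1)[OF T] by (simp add: g_def f_def gen_def cinner_Xi S_def adjoint_pair_def)
    then have "(norm (lincomb g ps))\<^sup>2 = Re (cinner (lincomb (f 0) ps) (lincomb (f 1) ps))"
      unfolding norm_power2_cinner by (intro arg_cong[of _ _ Re] cinner_lincomb_cong)
    also have "\<dots> \<le> norm (lincomb (f 0) ps) * norm (lincomb (f 1) ps)"
      by (meson complex_Re_le_cmod cinner_Cauchy_Schwarz order_trans)
    also have "\<dots> \<le> norm (lincomb (f 0) ps) * (norm S * norm (lincomb (f 0) ps))"
      by (intro mult_left_mono bound) simp
    also have "\<dots> = (sqrt (norm S) * norm (lincomb gen ps))\<^sup>2"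
      by (simp add: f0 power_mult_distrib) (simp add: power2_eq_square)
    finally show ?thesis by (rule power2_le_imp_le) simp
  qed
  then obtain F where F: "\<And>p. clop_apply F (gen p) = g p"
    using extend_from_total_family[OF total_gen] by metis
  have "\<forall>x h. clop_apply (induced T) (gen (x, h)) = gen (clop_apply T x, h)"
    unfolding induced_def by (rule someI[of _ F]) (simp add: F g_def)
  then show ?thesis by blast
qed

lemma clop_eq_genI:
  "(\<And>x h. clop_apply S (gen (x, h)) = clop_apply T (gen (x, h))) \<Longrightarrow> S = T"
  by (rule clop_eq_dense[OF total_gen]) auto

lemma induced_add: "S \<in> compacts \<Longrightarrow> T \<in> compacts \<Longrightarrow> induced (S + T) = induced S + induced T"
  by (rule clop_eq_genI,
      simp add: induced_apply complex_vector.subspace_add[OF csubspace_compacts] plus_clop.rep_eq,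
      simp add: gen_def Xi_add plus_clop.rep_eq)

lemma induced_scaleC: "T \<in> compacts \<Longrightarrow> induced (c *\<^sub>C T) = c *\<^sub>C induced T"
  by (rule clop_eq_genI,
      simp add: induced_apply complex_vector.subspace_scale[OF csubspace_compacts] scaleC_clop.rep_eq,
      simp add: gen_def Xi_scaleC scaleC_clop.rep_eq)

lemma induced_compose:
  "S \<in> compacts \<Longrightarrow> T \<in> compacts \<Longrightarrow> induced (S o\<^sub>C T) = induced S o\<^sub>C induced T"
  by (rule clop_eq_genI) (simp add: induced_apply compact_compose)

lemma induced_madj:
  assumes T: "T \<in> compacts"
  shows "induced (madj T) = adj (induced T)"
proof (intro clop_eq_genI cinner_ext_dense[OF total_gen])
  fix x h v assume "v \<in> range gen"
  then obtain y k where v: "v = gen (y, k)" by auto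
  show "cinner v (clop_apply (induced (madj T)) (gen (x, h))) = cinner v (clop_apply (adj (induced T)) (gen (x, h)))"
    using T by (simp add: v cinner_adj[symmetric] induced_apply compact_adjoint(2))
      (simp add: gen_def cinner_Xi ip_madj)
qed

lemma induced_theta: "induced (theta act ip x y) = \<Xi> x o\<^sub>C adj (\<Xi> y)"
proof (rule clop_eq_genI)
  fix z h
  have "clop_apply (adj (\<Xi> y)) (clop_apply (\<Xi> z) k) = clop_apply (\<pi> (ip y z)) k" for k
    using pi_map by (simp add: phi_map_def clop_compose_apply[symmetric] del: clop_compose_apply)
  then show "clop_apply (induced (theta act ip x y)) (gen (z, h)) = clop_apply (\<Xi> x o\<^sub>C adj (\<Xi> y)) (gen (z, h))"
    by (simp add: induced_apply theta_compact) (simp add: gen_def Xi_act)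
qed

end

text \<open>
  Agreement on the \<open>\<theta>\<close>-operators extends to their span by linearity, and to the closure of the span
  because representations of the closed *-algebra \<open>K(X)\<close> are automatically continuous.
\<close>

lemma (in hilbert_module) compact_star_rep_unique:
  fixes \<rho> \<rho>' :: "'x \<Rightarrow>\<^sub>\<complex> 'x \<Rightarrow> 'k::complex_hilbert \<Rightarrow>\<^sub>\<complex> 'k"
  assumes rep: "star_rep compacts (o\<^sub>C) madj \<rho>" "star_rep compacts (o\<^sub>C) madj \<rho>'"
    and eq: "\<And>x y. \<rho> (theta act ip x y) = \<rho>' (theta act ip x y)"
    and T: "T \<in> compacts"
  shows "\<rho> T = \<rho>' T"
proof -
  have bd: "norm (\<sigma> R) \<le> 2 * norm R"
    if \<sigma>: "star_rep compacts (o\<^sub>C) madj \<sigma>" and R: "R \<in> compacts"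
    for \<sigma> :: "'x \<Rightarrow>\<^sub>\<complex> 'x \<Rightarrow> 'k \<Rightarrow>\<^sub>\<complex> 'k" and R
  proof -
    have "(norm (\<sigma> R))\<^sup>2 \<le> norm (madj R o\<^sub>C R)"
      by (rule star_rep_norm_le[OF \<sigma> closed_compacts csubspace_compacts _ _ bounded_bilinear_clop_compose])
        (auto simp: compact_compose compact_adjoint(2) norm_clop_compose R)
    also have "\<dots> \<le> norm (madj R) * norm R" by (rule norm_clop_compose)
    also have "\<dots> \<le> 4 * norm R * norm R"
      by (intro mult_right_mono adjoint_pair_norm_le compact_adjoint(1) R) simp
    also have "\<dots> = (2 * norm R)\<^sup>2" by (simp add: power2_eq_square)
    finally show ?thesis by (rule power2_le_imp_le) simp
  qed
  have lin: "\<sigma> (R - R') = \<sigma> R - \<sigma> R'"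
    if \<sigma>: "star_rep compacts (o\<^sub>C) madj \<sigma>" and R: "R \<in> compacts" "R' \<in> compacts"
    for \<sigma> :: "'x \<Rightarrow>\<^sub>\<complex> 'x \<Rightarrow> 'k \<Rightarrow>\<^sub>\<complex> 'k" and R R'
  proof -
    have "\<sigma> ((R - R') + R') = \<sigma> (R - R') + \<sigma> R'"
      using \<sigma> R complex_vector.subspace_diff[OF csubspace_compacts] unfolding star_rep_def by blast
    then show ?thesis by simp
  qed
  define Q where "Q = {R \<in> compacts. \<rho> R = \<rho>' R}"
  have "compacts \<subseteq> Q"
  proof (rule compacts_subset)
    have "\<rho> 0 = 0" "\<rho>' 0 = 0"
      using lin[OF rep(1), of 0 0] lin[OF rep(2), of 0 0] complex_vector.subspace_0[OF csubspace_compacts]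
      by simp_all
    then show "complex_vector.subspace Q"
      using rep csubspace_compacts unfolding Q_def star_rep_def complex_vector.subspace_def by simp
    show "closed Q"
      unfolding closed_sequential_limits
    proof (intro allI impI, elim conjE)
      fix X R assume XQ: "\<forall>n. X n \<in> Q" and X: "X \<longlonglongrightarrow> R"
      then have Xc: "X n \<in> compacts" and Xe: "\<rho> (X n) = \<rho>' (X n)" for n by (auto simp: Q_def)
      have R: "R \<in> compacts" by (rule closed_sequentially[OF closed_compacts Xc X])
      have lim: "(\<lambda>n. \<sigma> (X n)) \<longlonglongrightarrow> \<sigma> R" if \<sigma>: "star_rep compacts (o\<^sub>C) madj \<sigma>"
        for \<sigma> :: "'x \<Rightarrow>\<^sub>\<complex> 'x \<Rightarrow> 'k \<Rightarrow>\<^sub>\<complex> 'k"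
      proof (rule LIM_zero_cancel, rule Lim_null_comparison)
        show "\<forall>\<^sub>F n in sequentially. norm (\<sigma> (X n) - \<sigma> R) \<le> 2 * norm (X n - R)"
          using bd[OF \<sigma> complex_vector.subspace_diff[OF csubspace_compacts Xc R]]
          by (simp add: lin[OF \<sigma> Xc R])
        show "(\<lambda>n. 2 * norm (X n - R)) \<longlonglongrightarrow> 0"
          using tendsto_mult_left[OF tendsto_norm[OF LIM_zero[OF X]], of 2] by simp
      qed
      have "\<rho> R = \<rho>' R" using lim[OF rep(1)] lim[OF rep(2)] by (auto simp: Xe intro: LIMSEQ_unique)
      then show "R \<in> Q" using R by (simp add: Q_def)
    qed
    show "theta act ip x y \<in> Q" for x y by (simp add: Q_def theta_compact eq)
  qed
  then show ?thesis using T by (auto simp: Q_def)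
qed

text \<open>
  The description that defines \<open>compact_rep\<close> is satisfied by \<open>W* \<sigma>(T) W\<close>, which is multiplicative since
  \<open>W W* = 1\<close>, and by no other map.
\<close>

lemma (in module_representation) compact_rep_eq:
  fixes W :: "'k::complex_hilbert \<Rightarrow>\<^sub>\<complex> 'k1"
  assumes W: "W o\<^sub>C adj W = clop_id" and T: "T \<in> compacts"
  shows "compact_rep act ip \<Xi> W T = adj W o\<^sub>C induced T o\<^sub>C W"
proof -
  define \<rho> where "\<rho> = restrict (\<lambda>T. adj W o\<^sub>C induced T o\<^sub>C W) compacts"
  have WW: "clop_apply W (clop_apply (adj W) k) = k" for k
    using W by (metis clop_compose_apply clop_id_apply)
  have rep: "star_rep compacts (o\<^sub>C) madj \<rho>"
    unfolding star_rep_def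
  proof (intro conjI ballI allI)
    fix S T c assume S: "S \<in> compacts"
    show "\<rho> (c *\<^sub>C S) = c *\<^sub>C \<rho> S"
      using S by (intro clop_eqI)
        (simp add: \<rho>_def complex_vector.subspace_scale[OF csubspace_compacts] induced_scaleC
          scaleC_clop.rep_eq clop_scaleC)
    show "\<rho> (madj S) = adj (\<rho> S)"
      using S by (simp add: \<rho>_def compact_adjoint(2) induced_madj clop_compose_assoc)
    assume T: "T \<in> compacts"
    show "\<rho> (S + T) = \<rho> S + \<rho> T"
      using S T by (intro clop_eqI)
        (simp add: \<rho>_def complex_vector.subspace_add[OF csubspace_compacts] induced_add
          plus_clop.rep_eq clop_add)
    show "\<rho> (S o\<^sub>C T) = \<rho> S o\<^sub>C \<rho> T"
      using S T by (intro clop_eqI) (simp add: \<rho>_def compact_compose induced_compose WW)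
  qed
  have th: "\<rho> (theta act ip x y) = adj W o\<^sub>C \<Xi> x o\<^sub>C adj (\<Xi> y) o\<^sub>C W" for x y
    by (simp add: \<rho>_def theta_compact induced_theta clop_compose_assoc)
  have "compact_rep act ip \<Xi> W = \<rho>"
    unfolding compact_rep_def
  proof (rule the_equality)
    show "\<rho> \<in> extensional compacts \<and> star_rep compacts (o\<^sub>C) madj \<rho> \<and>
        (\<forall>x y. \<rho> (theta act ip x y) = adj W o\<^sub>C \<Xi> x o\<^sub>C adj (\<Xi> y) o\<^sub>C W)"
      using rep th by (simp add: \<rho>_def)
  next
    fix \<sigma> assume \<sigma>: "\<sigma> \<in> extensional compacts \<and> star_rep compacts (o\<^sub>C) madj \<sigma> \<and>
        (\<forall>x y. \<sigma> (theta act ip x y) = adj W o\<^sub>C \<Xi> x o\<^sub>C adj (\<Xi> y) o\<^sub>C W)"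
    show "\<sigma> = \<rho>"
    proof (rule extensionalityI[of _ compacts])
      show "\<sigma> T = \<rho> T" if "T \<in> compacts" for T
      proof (rule compact_star_rep_unique[OF _ rep _ that])
        show "\<sigma> (theta act ip x y) = \<rho> (theta act ip x y)" for x y using \<sigma> th by metis
      qed (use \<sigma> in blast)
    qed (use \<sigma> in \<open>auto simp: \<rho>_def\<close>)
  qed
  then show ?thesis using T by (simp add: \<rho>_def)
qed

section \<open>Transport of multiplicative and ternary domains\<close>

text \<open>
  Since \<open>Y\<close> is a partial isometry and \<open>\<psi> = Y* \<psi>' Y\<close>, the projection \<open>Y* Y\<close> is a unit for the range of
  \<open>\<psi>\<close>; hence \<open>T \<mapsto> Y T Y*\<close> is multiplicative on products of elements of that range.
\<close>

lemma domains_transport_subset: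
  fixes Y :: "'e::complex_hilbert \<Rightarrow>\<^sub>\<complex> 'f::complex_hilbert"
  assumes closed: "\<And>a b. a \<in> B \<Longrightarrow> b \<in> B \<Longrightarrow> mul a b \<in> B" "\<And>a. a \<in> B \<Longrightarrow> st a \<in> B"
    and Y: "Y o\<^sub>C adj Y o\<^sub>C Y = Y"
    and fwd: "\<And>a. a \<in> B \<Longrightarrow> \<psi>' a = Y o\<^sub>C \<psi> a o\<^sub>C adj Y"
    and bwd: "\<And>a. a \<in> B \<Longrightarrow> \<psi> a = adj Y o\<^sub>C \<psi>' a o\<^sub>C Y"
  shows "mult_domain B mul \<psi> \<subseteq> mult_domain B mul \<psi>'"
    and "ternary_domain B mul st \<psi> \<subseteq> ternary_domain B mul st \<psi>'"
proof -
  have unit: "\<psi> a o\<^sub>C (adj Y o\<^sub>C Y) = \<psi> a" if "a \<in> B" for a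
    by (simp add: bwd[OF that] clop_compose_assoc Y[unfolded clop_compose_assoc])
  have unit_adj: "adj (\<psi> a) o\<^sub>C (adj Y o\<^sub>C Y) = adj (\<psi> a)" if "a \<in> B" for a
    by (simp add: bwd[OF that] clop_compose_assoc Y[unfolded clop_compose_assoc])
  have prod: "\<psi>' a o\<^sub>C \<psi>' b = Y o\<^sub>C (\<psi> a o\<^sub>C \<psi> b) o\<^sub>C adj Y" if "a \<in> B" "b \<in> B" for a b
  proof -
    have "\<psi>' a o\<^sub>C \<psi>' b = Y o\<^sub>C (\<psi> a o\<^sub>C (adj Y o\<^sub>C Y)) o\<^sub>C \<psi> b o\<^sub>C adj Y"
      by (simp only: fwd[OF that(1)] fwd[OF that(2)] clop_compose_assoc)
    then show ?thesis by (simp only: unit[OF that(1)] clop_compose_assoc)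
  qed
  have prod3: "\<psi>' b o\<^sub>C adj (\<psi>' a) o\<^sub>C \<psi>' c = Y o\<^sub>C (\<psi> b o\<^sub>C adj (\<psi> a) o\<^sub>C \<psi> c) o\<^sub>C adj Y"
    if "a \<in> B" "b \<in> B" "c \<in> B" for a b c
  proof -
    have "\<psi>' b o\<^sub>C adj (\<psi>' a) o\<^sub>C \<psi>' c
        = Y o\<^sub>C (\<psi> b o\<^sub>C (adj Y o\<^sub>C Y)) o\<^sub>C (adj (\<psi> a) o\<^sub>C (adj Y o\<^sub>C Y)) o\<^sub>C \<psi> c o\<^sub>C adj Y"
      by (simp only: fwd[OF that(1)] fwd[OF that(2)] fwd[OF that(3)] adj_compose adj_adj clop_compose_assoc)
    then show ?thesis by (simp only: unit[OF that(2)] unit_adj[OF that(1)] clop_compose_assoc)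
  qed
  show mult: "mult_domain B mul \<psi> \<subseteq> mult_domain B mul \<psi>'"
  proof
    fix a assume a: "a \<in> mult_domain B mul \<psi>"
    then have aB: "a \<in> B" by (simp add: mult_domain_def)
    have "\<psi>' (mul a b) = \<psi>' a o\<^sub>C \<psi>' b \<and> \<psi>' (mul b a) = \<psi>' b o\<^sub>C \<psi>' a" if "b \<in> B" for b
    proof -
      have "\<psi> (mul a b) = \<psi> a o\<^sub>C \<psi> b" "\<psi> (mul b a) = \<psi> b o\<^sub>C \<psi> a"
        using a that by (simp_all add: mult_domain_def)
      then show ?thesis
        by (simp only: prod[OF aB that] prod[OF that aB] fwd[OF closed(1)[OF aB that]]
            fwd[OF closed(1)[OF that aB]])
    qed
    with aB show "a \<in> mult_domain B mul \<psi>'" by (simp add: mult_domain_def)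
  qed
  show "ternary_domain B mul st \<psi> \<subseteq> ternary_domain B mul st \<psi>'"
  proof
    fix a assume a: "a \<in> ternary_domain B mul st \<psi>"
    then have aB: "a \<in> B" and "a \<in> mult_domain B mul \<psi>'"
      using mult by (auto simp: ternary_domain_def mult_domain_def)
    moreover have "\<psi>' (mul (mul b (st a)) c) = \<psi>' b o\<^sub>C adj (\<psi>' a) o\<^sub>C \<psi>' c" if "b \<in> B" "c \<in> B" for b c
    proof -
      have "\<psi> (mul (mul b (st a)) c) = \<psi> b o\<^sub>C adj (\<psi> a) o\<^sub>C \<psi> c"
        using a that by (simp add: ternary_domain_def)
      then show ?thesis
        by (simp only: prod3[OF aB that]
            fwd[OF closed(1)[OF closed(1)[OF that(1) closed(2)[OF aB]] that(2)]])
    qed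
    ultimately show "a \<in> ternary_domain B mul st \<psi>'" by (simp add: ternary_domain_def)
  qed
qed

lemma domains_transport:
  fixes Y :: "'e::complex_hilbert \<Rightarrow>\<^sub>\<complex> 'f::complex_hilbert"
  assumes closed: "\<And>a b. a \<in> B \<Longrightarrow> b \<in> B \<Longrightarrow> mul a b \<in> B" "\<And>a. a \<in> B \<Longrightarrow> st a \<in> B"
    and Y: "Y o\<^sub>C adj Y o\<^sub>C Y = Y"
    and fwd: "\<And>a. a \<in> B \<Longrightarrow> \<psi>' a = Y o\<^sub>C \<psi> a o\<^sub>C adj Y"
    and bwd: "\<And>a. a \<in> B \<Longrightarrow> \<psi> a = adj Y o\<^sub>C \<psi>' a o\<^sub>C Y"
  shows "mult_domain B mul \<psi> = mult_domain B mul \<psi>'"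
    and "ternary_domain B mul st \<psi> = ternary_domain B mul st \<psi>'"
proof -
  have "adj (Y o\<^sub>C adj Y o\<^sub>C Y) = adj Y" by (simp only: Y)
  then have Y': "adj Y o\<^sub>C adj (adj Y) o\<^sub>C adj Y = adj Y" by (simp add: clop_compose_assoc)
  have fwd': "\<psi>' a = adj (adj Y) o\<^sub>C \<psi> a o\<^sub>C adj Y" if "a \<in> B" for a
    unfolding adj_adj by (rule fwd[OF that])
  have bwd': "\<psi> a = adj Y o\<^sub>C \<psi>' a o\<^sub>C adj (adj Y)" if "a \<in> B" for a
    unfolding adj_adj by (rule bwd[OF that])
  note sub = domains_transport_subset[where B = B and mul = mul and st = st]
  show "mult_domain B mul \<psi> = mult_domain B mul \<psi>'"
    by (rule equalityI[OF sub(1)[OF closed Y fwd bwd] sub(1)[OF closed Y' bwd' fwd']])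
  show "ternary_domain B mul st \<psi> = ternary_domain B mul st \<psi>'"
    by (rule equalityI[OF sub(2)[OF closed Y fwd bwd] sub(2)[OF closed Y' bwd' fwd']])
qed

section \<open>The linking maps of two \<open>\<phi>\<close>-maps\<close>

lemma adj_block_op:
  "adj (block_op P Q R S) = block_op (adj P) (adj R) (adj Q) (adj S)"
  by (rule adj_eqI) (simp add: block_op.rep_eq cinner_prod_def cinner_linear cinner_adj)

lemma block_op_compose:
  "block_op P Q R S o\<^sub>C block_op P' Q' R' S' =
    block_op (P o\<^sub>C P' + Q o\<^sub>C R') (P o\<^sub>C Q' + Q o\<^sub>C S') (R o\<^sub>C P' + S o\<^sub>C R') (R o\<^sub>C Q' + S o\<^sub>C S')"
  by (rule clop_eqI) (simp add: block_op.rep_eq plus_clop.rep_eq clop_add)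

lemma clop_compose_zero [simp]: "T o\<^sub>C 0 = 0" "0 o\<^sub>C T = 0"
  by (rule clop_eqI, simp add: zero_clop.rep_eq)+

lemma clop_compose_id [simp]: "T o\<^sub>C clop_id = T" "clop_id o\<^sub>C T = T"
  by (rule clop_eqI, simp)+

lemma adj_zero [simp]: "adj 0 = 0"
  by (rule adj_eqI) (simp add: zero_clop.rep_eq)

lemma minimal_stinespring_module_representation:
  assumes "hilbert_module act ip" and "minimal_stinespring ip \<phi> \<Phi> \<pi> \<Xi> V W"
  shows "module_representation act ip \<pi> \<Xi> V"
  using assms
  by (simp add: module_representation_def module_representation_axioms_def minimal_stinespring_def)

abbreviation corner_extension :: "'a::complex_normed_vector \<Rightarrow>\<^sub>\<complex> 'b::complex_normed_vector
    \<Rightarrow> ('a \<times> 'h::complex_normed_vector) \<Rightarrow>\<^sub>\<complex> ('b \<times> 'h)" where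
  "corner_extension Z \<equiv> block_op Z 0 0 clop_id"

lemma clop_compose_cancel:
  assumes "S o\<^sub>C T = clop_id"
  shows "S o\<^sub>C (T o\<^sub>C R) = R"
  by (metis assms clop_compose_assoc clop_compose_id(2))

text \<open>
  The extension of \<open>Z\<close> by the identity satisfies \<open>Z \<Phi>(x) = \<Psi>(x)\<close> in the off-diagonal entries, and
  \<open>U \<sigma>1(T) U* = \<sigma>2(T)\<close> yields the upper left one.
\<close>

lemma linking_map_transport:
  assumes mod: "hilbert_module act ip"
    and m1: "minimal_stinespring ip \<phi> \<Phi> \<pi>1 \<Xi>1 V1 W1"
    and m2: "minimal_stinespring ip \<phi> \<Psi> \<pi>2 \<Xi>2 V2 W2"
    and U: "\<And>x h. clop_apply U (clop_apply (\<Xi>1 x) (clop_apply V1 h)) = clop_apply (\<Xi>2 x) (clop_apply V2 h)"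
    and UU: "U o\<^sub>C adj U = clop_id"
    and R: "R \<in> linking_algebra act ip"
  shows "linking_map act ip \<phi> \<Psi> \<Xi>2 W2 R =
    corner_extension (adj W2 o\<^sub>C U o\<^sub>C W1) o\<^sub>C linking_map act ip \<phi> \<Phi> \<Xi>1 W1 R
      o\<^sub>C adj (corner_extension (adj W2 o\<^sub>C U o\<^sub>C W1))"
proof -
  interpret M1: module_representation act ip \<pi>1 \<Xi>1 V1
    by (rule minimal_stinespring_module_representation[OF mod m1])
  interpret M2: module_representation act ip \<pi>2 \<Xi>2 V2
    by (rule minimal_stinespring_module_representation[OF mod m2])
  define Z where "Z = adj W2 o\<^sub>C U o\<^sub>C W1"
  have W: "W1 o\<^sub>C adj W1 = clop_id" "W2 o\<^sub>C adj W2 = clop_id"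
    and Phi: "\<Phi> x = adj W1 o\<^sub>C \<Xi>1 x o\<^sub>C V1" and Psi: "\<Psi> x = adj W2 o\<^sub>C \<Xi>2 x o\<^sub>C V2" for x
    using m1 m2 by (simp_all add: minimal_stinespring_def)
  obtain T x y a where T: "T \<in> compact_ops act ip" and R: "R = linking_op act ip T x y a"
    using R by (auto simp: linking_algebra_def)
  have UXi: "U o\<^sub>C (\<Xi>1 x o\<^sub>C V1) = \<Xi>2 x o\<^sub>C V2" for x
    by (rule clop_eqI) (simp add: U)
  have ZPhi: "Z o\<^sub>C \<Phi> x = \<Psi> x" for x
    by (simp add: Z_def Phi Psi clop_compose_assoc clop_compose_cancel[OF W(1)] UXi)
  have PhiZ: "adj (\<Phi> y) o\<^sub>C adj Z = adj (\<Psi> y)" for y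
    by (metis ZPhi adj_compose)
  have "U o\<^sub>C M1.induced T = M2.induced T o\<^sub>C U"
    by (rule M1.clop_eq_genI) (simp add: M1.induced_apply[OF T],
      simp add: M1.gen_def U M2.induced_apply[OF T, unfolded M2.gen_def, simplified])
  then have "U o\<^sub>C (M1.induced T o\<^sub>C adj U) = M2.induced T"
    by (metis UU clop_compose_assoc clop_compose_id(1))
  then have UindU: "U o\<^sub>C (M1.induced T o\<^sub>C (adj U o\<^sub>C S)) = M2.induced T o\<^sub>C S"
    for S :: "_ \<Rightarrow>\<^sub>\<complex> _" by (metis clop_compose_assoc)
  have "Z o\<^sub>C (compact_rep act ip \<Xi>1 W1 T o\<^sub>C adj Z) = compact_rep act ip \<Xi>2 W2 T"
    by (simp add: M1.compact_rep_eq[OF W(1) T] M2.compact_rep_eq[OF W(2) T] Z_def clop_compose_assoc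
        clop_compose_cancel[OF W(1)] UindU)
  then show ?thesis
    unfolding Z_def[symmetric] R M1.linking_map_linking_op[OF T]
    by (simp add: adj_block_op block_op_compose ZPhi PhiZ clop_compose_assoc)
qed

theorem corollary5p9:
  fixes act :: "'x::complex_banach \<Rightarrow> 'a::cstar_algebra \<Rightarrow> 'x"
    and ip :: "'x \<Rightarrow> 'x \<Rightarrow> 'a"
    and \<phi> :: "'a \<Rightarrow> 'h::complex_hilbert \<Rightarrow>\<^sub>\<complex> 'h"
    and \<Phi> :: "'x \<Rightarrow> 'h \<Rightarrow>\<^sub>\<complex> 'k1::complex_hilbert"
    and \<Psi> :: "'x \<Rightarrow> 'h \<Rightarrow>\<^sub>\<complex> 'k2::complex_hilbert"
    and \<pi>1 :: "'a \<Rightarrow> 'h1::complex_hilbert \<Rightarrow>\<^sub>\<complex> 'h1"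
    and \<Xi>1 :: "'x \<Rightarrow> 'h1 \<Rightarrow>\<^sub>\<complex> 'l1::complex_hilbert"
    and V1 :: "'h \<Rightarrow>\<^sub>\<complex> 'h1" and W1 :: "'k1 \<Rightarrow>\<^sub>\<complex> 'l1"
    and \<pi>2 :: "'a \<Rightarrow> 'h2::complex_hilbert \<Rightarrow>\<^sub>\<complex> 'h2"
    and \<Xi>2 :: "'x \<Rightarrow> 'h2 \<Rightarrow>\<^sub>\<complex> 'l2::complex_hilbert"
    and V2 :: "'h \<Rightarrow>\<^sub>\<complex> 'h2" and W2 :: "'k2 \<Rightarrow>\<^sub>\<complex> 'l2"
  assumes "hilbert_module act ip"
    and "completely_positive \<phi>"
    and "phi_map ip \<phi> \<Phi>"
    and "phi_map ip \<phi> \<Psi>"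
    and "minimal_stinespring ip \<phi> \<Phi> \<pi>1 \<Xi>1 V1 W1"
    and "minimal_stinespring ip \<phi> \<Psi> \<pi>2 \<Xi>2 V2 W2"
  shows "mult_domain (linking_algebra act ip) (o\<^sub>C) (linking_map act ip \<phi> \<Phi> \<Xi>1 W1)
       = mult_domain (linking_algebra act ip) (o\<^sub>C) (linking_map act ip \<phi> \<Psi> \<Xi>2 W2)
       \<and> ternary_domain (linking_algebra act ip) (o\<^sub>C) (linking_star ip) (linking_map act ip \<phi> \<Phi> \<Xi>1 W1)
       = ternary_domain (linking_algebra act ip) (o\<^sub>C) (linking_star ip) (linking_map act ip \<phi> \<Psi> \<Xi>2 W2)"
proof -
  interpret hilbert_module act ip by fact
  note m1 = \<open>minimal_stinespring ip \<phi> \<Phi> \<pi>1 \<Xi>1 V1 W1\<close>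
  note m2 = \<open>minimal_stinespring ip \<phi> \<Psi> \<pi>2 \<Xi>2 V2 W2\<close>
  interpret M1: module_representation act ip \<pi>1 \<Xi>1 V1
    by (rule minimal_stinespring_module_representation[OF assms(1) m1])
  interpret M2: module_representation act ip \<pi>2 \<Xi>2 V2
    by (rule minimal_stinespring_module_representation[OF assms(1) m2])
  have W: "W1 o\<^sub>C adj W1 = clop_id" "W2 o\<^sub>C adj W2 = clop_id"
    and phi: "\<phi> a = adj V1 o\<^sub>C \<pi>1 a o\<^sub>C V1" "\<phi> a = adj V2 o\<^sub>C \<pi>2 a o\<^sub>C V2" for a
    using m1 m2 by (simp_all add: minimal_stinespring_def)
  have "cinner (M1.gen p) (M1.gen q) = cinner (snd p) (clop_apply (\<phi> (ip (fst p) (fst q))) (snd q))" for p q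
    by (simp add: M1.gen_def M1.cinner_Xi phi(1) cinner_adj[symmetric])
  moreover have "cinner (M2.gen p) (M2.gen q) = cinner (snd p) (clop_apply (\<phi> (ip (fst p) (fst q))) (snd q))" for p q
    by (simp add: M2.gen_def M2.cinner_Xi phi(2) cinner_adj[symmetric])
  ultimately obtain U where U: "\<And>p. clop_apply U (M1.gen p) = M2.gen p"
    and UU: "adj U o\<^sub>C U = clop_id" "U o\<^sub>C adj U = clop_id"
    using unitary_of_total_families[OF M1.total_gen M2.total_gen] by metis
  have U1: "clop_apply U (clop_apply (\<Xi>1 x) (clop_apply V1 h)) = clop_apply (\<Xi>2 x) (clop_apply V2 h)" for x h
    using U[of "(x, h)"] by (simp add: M1.gen_def M2.gen_def)
  have U2: "clop_apply (adj U) (clop_apply (\<Xi>2 x) (clop_apply V2 h)) = clop_apply (\<Xi>1 x) (clop_apply V1 h)" for x h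
    by (metis U1 UU(1) clop_compose_apply clop_id_apply)
  define Z where "Z = adj W2 o\<^sub>C U o\<^sub>C W1"
  define Y :: "('k1 \<times> 'h) \<Rightarrow>\<^sub>\<complex> ('k2 \<times> 'h)" where "Y = corner_extension Z"
  have "Z o\<^sub>C (adj Z o\<^sub>C Z) = Z"
    by (simp add: Z_def clop_compose_assoc clop_compose_cancel[OF W(1)] clop_compose_cancel[OF W(2)]
        clop_compose_cancel[OF UU(1)])
  then have Y: "Y o\<^sub>C adj Y o\<^sub>C Y = Y"
    by (simp add: Y_def adj_block_op block_op_compose clop_compose_assoc)
  have adjY: "adj Y = corner_extension (adj W1 o\<^sub>C adj U o\<^sub>C W2)"
    by (simp add: Y_def Z_def adj_block_op clop_compose_assoc)
  have UU': "adj U o\<^sub>C adj (adj U) = clop_id" by (simp add: UU)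
  have fwd: "linking_map act ip \<phi> \<Psi> \<Xi>2 W2 R = Y o\<^sub>C linking_map act ip \<phi> \<Phi> \<Xi>1 W1 R o\<^sub>C adj Y"
    if "R \<in> linking_algebra act ip" for R
    unfolding Y_def Z_def by (rule linking_map_transport[OF assms(1) m1 m2 U1 UU(2) that])
  have bwd: "linking_map act ip \<phi> \<Phi> \<Xi>1 W1 R = adj Y o\<^sub>C linking_map act ip \<phi> \<Psi> \<Xi>2 W2 R o\<^sub>C Y"
    if "R \<in> linking_algebra act ip" for R
    using linking_map_transport[OF assms(1) m2 m1 U2 UU' that]
    unfolding adjY[symmetric] by simp
  note transport = domains_transport[OF linking_algebra_compose linking_algebra_star Y fwd bwd]
  show ?thesis by (intro conjI transport)
qed

end
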